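(* The functor $\mathscr{A}$ is a strong monoidal functor.
   Context: $\mathscr{A}\colon\mathsf{TS}_\ltimes\to\mathsf{HDA_{ext}}$ is the functor from $\ltimes$-transition systems (transition systems with a relation $\ltimes$ on labels) to extensional HDAs (HDAs in which two edges with the same label and endpoints are equal) defined as $\varGamma_2\circ\varPsi$, where $\varPsi(\mathcal{T})$ is the 2-truncated HDA whose 1-skeleton is the underlying transition system $U(\mathcal{T})$ and whose 2-cubes are the independence squares of $\mathcal{T}$ (families of edges $(x^k_i)$ with $d^k_1x^l_2=d^l_1x^k_1$ and $\lambda(x^0_2)=\lambda(x^1_2)\ltimes_\mathcal{T}\lambda(x^0_1)=\lambda(x^1_1)$), and $\varGamma_2$ is the 2-coskeleton functor; $\mathscr{A}(\mathcal{T})$ is an HDA model of $\mathcal{T}$ (obtained by filling all admissible empty cubes). The monoidal structure on $\mathsf{TS}_\ltimes$ is the interleaving $\mathcal{S}\mathbin{|||}\mathcal{T}$: underlying transition system $(U(\mathcal{S})\otimes U(\mathcal{T}))_{\le1}$, with $\alpha\ltimes\beta$ iff either $\alpha,\beta\in\Sigma_\mathcal{S}$ and $\alpha\ltimes_\mathcal{S}\beta$, or $\alpha,\beta\in\Sigma_\mathcal{T}$ and $\alpha\ltimes_\mathcal{T}\beta$, or $\alpha\in\Sigma_\mathcal{S}$ and $\beta\in\Sigma_\mathcal{T}$. The monoidal structure on $\mathsf{HDA_{ext}}$ is the tensor product of HDAs (tensor product of precubical sets, initial state the pair of initial states, final states the product, labels the disjoint union). The structure isomorphism is the unique isomorphism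 $\mathscr{A}(\mathcal{S})\otimes\mathscr{A}(\mathcal{T})\cong\mathscr{A}(\mathcal{S}\mathbin{|||}\mathcal{T})$ restricting to the identity on $U(\mathcal{S}\mathbin{|||}\mathcal{T})$. *)

theory Defs
  imports Main "HOL-Library.FuncSet"
begin

section \<open>Monoidal categories and strong monoidal functors\<close>

record ('o, 'a) cat_data =
  Obj :: "'o set"
  Arr :: "'a set"
  Dom :: "'a \<Rightarrow> 'o"
  Cod :: "'a \<Rightarrow> 'o"
  Id :: "'o \<Rightarrow> 'a"
  Comp :: "'a \<Rightarrow> 'a \<Rightarrow> 'a"  (* Comp C g f is g after f *)

definition Hom :: "('o, 'a, 'm) cat_data_scheme \<Rightarrow> 'o \<Rightarrow> 'o \<Rightarrow> 'a set" where
  "Hom C X Y = {f \<in> Arr C. Dom C f = X \<and> Cod C f = Y}"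

definition is_iso :: "('o, 'a, 'm) cat_data_scheme \<Rightarrow> 'a \<Rightarrow> bool" where
  "is_iso C f \<longleftrightarrow> f \<in> Arr C \<and>
     (\<exists>g \<in> Hom C (Cod C f) (Dom C f).
        Comp C g f = Id C (Dom C f) \<and> Comp C f g = Id C (Cod C f))"

locale category =
  fixes C :: "('o, 'a, 'm) cat_data_scheme"
  assumes dom_obj: "f \<in> Arr C \<Longrightarrow> Dom C f \<in> Obj C"
    and cod_obj: "f \<in> Arr C \<Longrightarrow> Cod C f \<in> Obj C"
    and id_hom: "X \<in> Obj C \<Longrightarrow> Id C X \<in> Hom C X X"
    and comp_hom: "\<lbrakk>f \<in> Hom C X Y; g \<in> Hom C Y Z\<rbrakk> \<Longrightarrow> Comp C g f \<in> Hom C X Z"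
    and comp_id_left: "f \<in> Hom C X Y \<Longrightarrow> Comp C (Id C Y) f = f"
    and comp_id_right: "f \<in> Hom C X Y \<Longrightarrow> Comp C f (Id C X) = f"
    and comp_assoc: "\<lbrakk>f \<in> Hom C W X; g \<in> Hom C X Y; h \<in> Hom C Y Z\<rbrakk>
           \<Longrightarrow> Comp C h (Comp C g f) = Comp C (Comp C h g) f"

record ('o, 'a, 'p, 'b) functor_data =
  map_obj :: "'o \<Rightarrow> 'p"
  map_arr :: "'a \<Rightarrow> 'b"

definition functor_comp ::
  "('p, 'b, 'q, 'c) functor_data \<Rightarrow> ('o, 'a, 'p, 'b) functor_data \<Rightarrow> ('o, 'a, 'q, 'c) functor_data"
  where "functor_comp G F = \<lparr>map_obj = map_obj G \<circ> map_obj F, map_arr = map_arr G \<circ> map_arr F\<rparr>"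

locale category_functor = source: category C + target: category D
  for C :: "('o, 'a, 'm) cat_data_scheme" and D :: "('p, 'b, 'n) cat_data_scheme" +
  fixes F :: "('o, 'a, 'p, 'b) functor_data"
  assumes map_obj_obj: "X \<in> Obj C \<Longrightarrow> map_obj F X \<in> Obj D"
    and map_arr_hom: "f \<in> Hom C X Y \<Longrightarrow> map_arr F f \<in> Hom D (map_obj F X) (map_obj F Y)"
    and map_arr_id: "X \<in> Obj C \<Longrightarrow> map_arr F (Id C X) = Id D (map_obj F X)"
    and map_arr_comp: "\<lbrakk>f \<in> Hom C X Y; g \<in> Hom C Y Z\<rbrakk>
           \<Longrightarrow> map_arr F (Comp C g f) = Comp D (map_arr F g) (map_arr F f)"

record ('o, 'a) moncat_data = "('o, 'a) cat_data" +
  Tens_obj :: "'o \<Rightarrow> 'o \<Rightarrow> 'o"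
  Tens_arr :: "'a \<Rightarrow> 'a \<Rightarrow> 'a"
  Unit :: "'o"
  Assoc :: "'o \<Rightarrow> 'o \<Rightarrow> 'o \<Rightarrow> 'a"
  Lunit :: "'o \<Rightarrow> 'a"
  Runit :: "'o \<Rightarrow> 'a"

locale monoidal_category = category C
  for C :: "('o, 'a, 'm) moncat_data_scheme" +
  assumes tens_obj: "\<lbrakk>X \<in> Obj C; Y \<in> Obj C\<rbrakk> \<Longrightarrow> Tens_obj C X Y \<in> Obj C"
    and tens_hom: "\<lbrakk>f \<in> Hom C X X'; g \<in> Hom C Y Y'\<rbrakk>
           \<Longrightarrow> Tens_arr C f g \<in> Hom C (Tens_obj C X Y) (Tens_obj C X' Y')"
    and tens_id: "\<lbrakk>X \<in> Obj C; Y \<in> Obj C\<rbrakk>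
           \<Longrightarrow> Tens_arr C (Id C X) (Id C Y) = Id C (Tens_obj C X Y)"
    and tens_comp: "\<lbrakk>f \<in> Hom C X X'; f' \<in> Hom C X' X''; g \<in> Hom C Y Y'; g' \<in> Hom C Y' Y''\<rbrakk>
           \<Longrightarrow> Tens_arr C (Comp C f' f) (Comp C g' g) = Comp C (Tens_arr C f' g') (Tens_arr C f g)"
    and unit_obj: "Unit C \<in> Obj C"
    and assoc_hom: "\<lbrakk>X \<in> Obj C; Y \<in> Obj C; Z \<in> Obj C\<rbrakk>
           \<Longrightarrow> Assoc C X Y Z \<in> Hom C (Tens_obj C (Tens_obj C X Y) Z) (Tens_obj C X (Tens_obj C Y Z))"
    and assoc_iso: "\<lbrakk>X \<in> Obj C; Y \<in> Obj C; Z \<in> Obj C\<rbrakk> \<Longrightarrow> is_iso C (Assoc C X Y Z)"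
    and assoc_natural: "\<lbrakk>f \<in> Hom C X X'; g \<in> Hom C Y Y'; h \<in> Hom C Z Z'\<rbrakk>
           \<Longrightarrow> Comp C (Assoc C X' Y' Z') (Tens_arr C (Tens_arr C f g) h)
             = Comp C (Tens_arr C f (Tens_arr C g h)) (Assoc C X Y Z)"
    and lunit_hom: "X \<in> Obj C \<Longrightarrow> Lunit C X \<in> Hom C (Tens_obj C (Unit C) X) X"
    and lunit_iso: "X \<in> Obj C \<Longrightarrow> is_iso C (Lunit C X)"
    and lunit_natural: "f \<in> Hom C X X'
           \<Longrightarrow> Comp C (Lunit C X') (Tens_arr C (Id C (Unit C)) f) = Comp C f (Lunit C X)"
    and runit_hom: "X \<in> Obj C \<Longrightarrow> Runit C X \<in> Hom C (Tens_obj C X (Unit C)) X"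
    and runit_iso: "X \<in> Obj C \<Longrightarrow> is_iso C (Runit C X)"
    and runit_natural: "f \<in> Hom C X X'
           \<Longrightarrow> Comp C (Runit C X') (Tens_arr C f (Id C (Unit C))) = Comp C f (Runit C X)"
    and pentagon: "\<lbrakk>W \<in> Obj C; X \<in> Obj C; Y \<in> Obj C; Z \<in> Obj C\<rbrakk>
           \<Longrightarrow> Comp C (Assoc C W X (Tens_obj C Y Z)) (Assoc C (Tens_obj C W X) Y Z)
             = Comp C (Tens_arr C (Id C W) (Assoc C X Y Z))
                 (Comp C (Assoc C W (Tens_obj C X Y) Z) (Tens_arr C (Assoc C W X Y) (Id C Z)))"
    and triangle: "\<lbrakk>X \<in> Obj C; Y \<in> Obj C\<rbrakk>
           \<Longrightarrow> Comp C (Tens_arr C (Id C X) (Lunit C Y)) (Assoc C X (Unit C) Y)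
             = Tens_arr C (Runit C X) (Id C Y)"

locale strong_monoidal_functor =
  category_functor C D F + source: monoidal_category C + target: monoidal_category D
  for C :: "('o, 'a, 'm) moncat_data_scheme" and D :: "('p, 'b, 'n) moncat_data_scheme"
    and F :: "('o, 'a, 'p, 'b) functor_data" +
  fixes \<phi> :: "'o \<Rightarrow> 'o \<Rightarrow> 'b" and \<epsilon> :: "'b"
  assumes mult_hom: "\<lbrakk>X \<in> Obj C; Y \<in> Obj C\<rbrakk>
           \<Longrightarrow> \<phi> X Y \<in> Hom D (Tens_obj D (map_obj F X) (map_obj F Y)) (map_obj F (Tens_obj C X Y))"
    and mult_iso: "\<lbrakk>X \<in> Obj C; Y \<in> Obj C\<rbrakk> \<Longrightarrow> is_iso D (\<phi> X Y)"
    and mult_natural: "\<lbrakk>f \<in> Hom C X X'; g \<in> Hom C Y Y'\<rbrakk>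
           \<Longrightarrow> Comp D (\<phi> X' Y') (Tens_arr D (map_arr F f) (map_arr F g))
             = Comp D (map_arr F (Tens_arr C f g)) (\<phi> X Y)"
    and counit_hom: "\<epsilon> \<in> Hom D (Unit D) (map_obj F (Unit C))"
    and counit_iso: "is_iso D \<epsilon>"
    and mult_assoc: "\<lbrakk>X \<in> Obj C; Y \<in> Obj C; Z \<in> Obj C\<rbrakk>
           \<Longrightarrow> Comp D (map_arr F (Assoc C X Y Z))
                 (Comp D (\<phi> (Tens_obj C X Y) Z) (Tens_arr D (\<phi> X Y) (Id D (map_obj F Z))))
             = Comp D (\<phi> X (Tens_obj C Y Z))
                 (Comp D (Tens_arr D (Id D (map_obj F X)) (\<phi> Y Z))
                   (Assoc D (map_obj F X) (map_obj F Y) (map_obj F Z)))"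
    and mult_lunit: "X \<in> Obj C
           \<Longrightarrow> Comp D (map_arr F (Lunit C X))
                 (Comp D (\<phi> (Unit C) X) (Tens_arr D \<epsilon> (Id D (map_obj F X))))
             = Lunit D (map_obj F X)"
    and mult_runit: "X \<in> Obj C
           \<Longrightarrow> Comp D (map_arr F (Runit C X))
                 (Comp D (\<phi> X (Unit C)) (Tens_arr D (Id D (map_obj F X)) \<epsilon>))
             = Runit D (map_obj F X)"


section \<open>Higher-dimensional automata\<close>

text \<open>
  The cubes and labels of all automata are drawn from one type of elements, freely generated from
  an arbitrary type \<open>'a\<close> of atoms, so that a single type of automata is closed under the tensor
  product and the coskeleton. Since \<open>'a\<close> is arbitrary and sets of atoms can be of any size, this
  amounts to working with automata whose sets of cubes and labels lie in a fixed universe.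

  \<open>Pair p x q y\<close> is the element \<open>(x, y)\<close> of the summand \<open>P\<^sub>p \<times> Q\<^sub>q\<close> of \<open>(P \<otimes> Q)\<^sub>p\<^sub>+\<^sub>q\<close>. \<open>Left\<close> and
  \<open>Right\<close> are the injections into a disjoint union of alphabets.
  \<open>Family [(x\<^sub>1\<^sup>0, x\<^sub>1\<^sup>1), \<dots>, (x\<^sub>n\<^sup>0, x\<^sub>n\<^sup>1)]\<close> is a family of \<open>(n-1)\<close>-cubes considered as an \<open>n\<close>-cube.
\<close>

datatype 'a el =
    Atom 'a
  | Point
  | Pair nat "'a el" nat "'a el"
  | Left "'a el"
  | Right "'a el"
  | Family "('a el \<times> 'a el) list"

text \<open>
  \<open>face A n k i\<close> is the boundary operator \<open>d\<^sub>i\<^sup>k\<close> from \<open>n\<close>-cubes to \<open>(n-1)\<close>-cubes, \<open>1 \<le> i \<le> n\<close>, with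
  \<open>False\<close>, \<open>True\<close> standing for \<open>k = 0, 1\<close>. Different degrees need not be disjoint. As in HOL-Algebra,
  the values of \<open>face\<close> and \<open>label\<close> outside their mathematical domains are irrelevant.
\<close>

record 'e hda =
  Cubes :: "nat \<Rightarrow> 'e set"
  face :: "nat \<Rightarrow> bool \<Rightarrow> nat \<Rightarrow> 'e \<Rightarrow> 'e"
  Init :: 'e
  Final :: "'e set"
  Labels :: "'e set"
  label :: "'e \<Rightarrow> 'e"

definition is_hda :: "('e, 'm) hda_scheme \<Rightarrow> bool" where
  "is_hda A \<longleftrightarrow>
     (\<forall>n k i. 1 \<le> i \<and> i \<le> n \<longrightarrow> face A n k i \<in> Cubes A n \<rightarrow> Cubes A (n - 1)) \<and>
     (\<forall>n k l i j. \<forall>x \<in> Cubes A n. 1 \<le> i \<and> i < j \<and> j \<le> n \<longrightarrow>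
        face A (n - 1) k i (face A n l j x) = face A (n - 1) l (j - 1) (face A n k i x)) \<and>
     Init A \<in> Cubes A 0 \<and>
     Final A \<subseteq> Cubes A 0 \<and>
     label A \<in> Cubes A 1 \<rightarrow> Labels A \<and>
     (\<forall>x \<in> Cubes A 2. \<forall>i \<in> {1, 2}. label A (face A 2 False i x) = label A (face A 2 True i x))"

definition is_extensional :: "('e, 'm) hda_scheme \<Rightarrow> bool" where
  "is_extensional A \<longleftrightarrow>
     (\<forall>x \<in> Cubes A 1. \<forall>y \<in> Cubes A 1.
        label A x = label A y \<and> face A 1 False 1 x = face A 1 False 1 y \<and>
        face A 1 True 1 x = face A 1 True 1 y \<longrightarrow> x = y)"

definition is_truncated :: "nat \<Rightarrow> ('e, 'm) hda_scheme \<Rightarrow> bool" where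
  "is_truncated N A \<longleftrightarrow> (\<forall>n > N. Cubes A n = {})"

definition skeleton :: "nat \<Rightarrow> 'e hda \<Rightarrow> 'e hda" where
  "skeleton N A = A\<lparr>Cubes := \<lambda>n. if n \<le> N then Cubes A n else {}\<rparr>"

text \<open>A \<open>\<ltimes>\<close>-transition system; its underlying transition system \<open>U(\<T>)\<close> is \<open>hda.truncate \<T>\<close>.\<close>

record 'e lts = "'e hda" +
  ltimes :: "('e \<times> 'e) set"

definition is_transition_system :: "('e, 'm) hda_scheme \<Rightarrow> bool" where
  "is_transition_system T \<longleftrightarrow> is_hda T \<and> is_extensional T \<and> is_truncated 1 T"

definition is_lts :: "'e lts \<Rightarrow> bool" where
  "is_lts T \<longleftrightarrow> is_transition_system T \<and> ltimes T \<subseteq> Labels T \<times> Labels T"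


section \<open>Morphisms\<close>

text \<open>
  A morphism is a map of cubes together with a map of alphabets. Both are extensional functions
  (\<open>undefined\<close> outside their domains), so that equality of morphisms is equality of the maps.
\<close>

record ('o, 'e) mor =
  src :: 'o
  tgt :: 'o
  on_cubes :: "nat \<Rightarrow> 'e \<Rightarrow> 'e"
  on_labels :: "'e \<Rightarrow> 'e"

definition is_hda_mor :: "(('e, 'm) hda_scheme, 'e) mor \<Rightarrow> bool" where
  "is_hda_mor f \<longleftrightarrow>
     (\<forall>n. on_cubes f n \<in> Cubes (src f) n \<rightarrow>\<^sub>E Cubes (tgt f) n) \<and>
     (\<forall>n k i. \<forall>x \<in> Cubes (src f) n. 1 \<le> i \<and> i \<le> n \<longrightarrow>
        on_cubes f (n - 1) (face (src f) n k i x) = face (tgt f) n k i (on_cubes f n x)) \<and>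
     on_cubes f 0 (Init (src f)) = Init (tgt f) \<and>
     on_cubes f 0 ` Final (src f) \<subseteq> Final (tgt f) \<and>
     on_labels f \<in> Labels (src f) \<rightarrow>\<^sub>E Labels (tgt f) \<and>
     (\<forall>x \<in> Cubes (src f) 1. label (tgt f) (on_cubes f 1 x) = on_labels f (label (src f) x))"

definition is_lts_mor :: "('e lts, 'e) mor \<Rightarrow> bool" where
  "is_lts_mor f \<longleftrightarrow> is_hda_mor f \<and>
     (\<forall>(a, b) \<in> ltimes (src f). (on_labels f a, on_labels f b) \<in> ltimes (tgt f))"

definition mk_mor ::
  "('e, 'm) hda_scheme \<Rightarrow> ('e, 'm) hda_scheme \<Rightarrow> (nat \<Rightarrow> 'e \<Rightarrow> 'e) \<Rightarrow> ('e \<Rightarrow> 'e) \<Rightarrow>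
     (('e, 'm) hda_scheme, 'e) mor"
  where "mk_mor A B f s =
    \<lparr>src = A, tgt = B, on_cubes = \<lambda>n. restrict (f n) (Cubes A n), on_labels = restrict s (Labels A)\<rparr>"

definition id_mor :: "('e, 'm) hda_scheme \<Rightarrow> (('e, 'm) hda_scheme, 'e) mor" where
  "id_mor A = mk_mor A A (\<lambda>n x. x) (\<lambda>a. a)"

definition comp_mor ::
  "(('e, 'm) hda_scheme, 'e) mor \<Rightarrow> (('e, 'm) hda_scheme, 'e) mor \<Rightarrow> (('e, 'm) hda_scheme, 'e) mor"
  where "comp_mor g f =
    mk_mor (src f) (tgt g) (\<lambda>n. on_cubes g n \<circ> on_cubes f n) (on_labels g \<circ> on_labels f)"


section \<open>Tensor product and interleaving\<close>

primrec tensor_face ::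
  "('a el, 'm) hda_scheme \<Rightarrow> ('a el, 'm) hda_scheme \<Rightarrow> bool \<Rightarrow> nat \<Rightarrow> 'a el \<Rightarrow> 'a el" where
  "tensor_face A B k i (Pair p x q y) =
     (if i \<le> p then Pair (p - 1) (face A p k i x) q y
      else Pair p x (q - 1) (face B q k (i - p) y))"

primrec tensor_label ::
  "('a el, 'm) hda_scheme \<Rightarrow> ('a el, 'm) hda_scheme \<Rightarrow> 'a el \<Rightarrow> 'a el" where
  "tensor_label A B (Pair p x q y) = (if p = 1 then Left (label A x) else Right (label B y))"

definition tensor :: "('a el, 'm) hda_scheme \<Rightarrow> ('a el, 'm) hda_scheme \<Rightarrow> 'a el hda" where
  "tensor A B =
     \<lparr>Cubes = \<lambda>n. {Pair p x q y | p x q y. p + q = n \<and> x \<in> Cubes A p \<and> y \<in> Cubes B q},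
      face = \<lambda>n. tensor_face A B,
      Init = Pair 0 (Init A) 0 (Init B),
      Final = {Pair 0 x 0 y | x y. x \<in> Final A \<and> y \<in> Final B},
      Labels = Left ` Labels A \<union> Right ` Labels B,
      label = tensor_label A B\<rparr>"

definition unit_hda :: "'a el hda" where
  "unit_hda =
     \<lparr>Cubes = \<lambda>n. if n = 0 then {Point} else {}, face = \<lambda>n k i x. x,
      Init = Point, Final = {Point}, Labels = {}, label = \<lambda>x. x\<rparr>"

definition interleave :: "'a el lts \<Rightarrow> 'a el lts \<Rightarrow> 'a el lts" where
  "interleave S T =
     hda.extend (skeleton 1 (tensor (hda.truncate S) (hda.truncate T)))
       (lts.fields
          ({(Left a, Left b) | a b. (a, b) \<in> ltimes S} \<union>
           {(Right a, Right b) | a b. (a, b) \<in> ltimes T} \<union>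
           {(Left a, Right b) | a b. a \<in> Labels S \<and> b \<in> Labels T}))"

definition unit_lts :: "'a el lts" where
  "unit_lts = hda.extend unit_hda (lts.fields {})"

text \<open>
  The tensor product of morphisms and the structure maps are given by the same formulas for HDAs
  and, in degrees at most 1, for \<open>\<ltimes>\<close>-transition systems; only the objects \<open>A\<close>, \<open>B\<close> between which
  the morphism runs are different (see \<open>mk_mor\<close>, which also restricts the maps to their domains).
\<close>

primrec pair_map :: "(nat \<Rightarrow> 'a el \<Rightarrow> 'a el) \<Rightarrow> (nat \<Rightarrow> 'a el \<Rightarrow> 'a el) \<Rightarrow> 'a el \<Rightarrow> 'a el" where
  "pair_map f g (Pair p x q y) = Pair p (f p x) q (g q y)"

primrec sum_map :: "('a el \<Rightarrow> 'a el) \<Rightarrow> ('a el \<Rightarrow> 'a el) \<Rightarrow> 'a el \<Rightarrow> 'a el" where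
  "sum_map s t (Left a) = Left (s a)"
| "sum_map s t (Right a) = Right (t a)"

fun assoc_cube :: "'a el \<Rightarrow> 'a el" where
  "assoc_cube (Pair m (Pair p x q y) r z) = Pair p x (q + r) (Pair q y r z)"

fun assoc_label :: "'a el \<Rightarrow> 'a el" where
  "assoc_label (Left (Left a)) = Left a"
| "assoc_label (Left (Right a)) = Right (Left a)"
| "assoc_label (Right a) = Right (Right a)"

primrec pair_fst :: "'a el \<Rightarrow> 'a el" where
  "pair_fst (Pair p x q y) = x"

primrec pair_snd :: "'a el \<Rightarrow> 'a el" where
  "pair_snd (Pair p x q y) = y"

primrec from_left :: "'a el \<Rightarrow> 'a el" where
  "from_left (Left a) = a"

primrec from_right :: "'a el \<Rightarrow> 'a el" where
  "from_right (Right a) = a"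

definition tensor_mor ::
  "(('a el, 'm) hda_scheme \<Rightarrow> ('a el, 'm) hda_scheme \<Rightarrow> ('a el, 'm) hda_scheme) \<Rightarrow>
     (('a el, 'm) hda_scheme, 'a el) mor \<Rightarrow> (('a el, 'm) hda_scheme, 'a el) mor \<Rightarrow>
     (('a el, 'm) hda_scheme, 'a el) mor" where
  "tensor_mor tens f g =
     mk_mor (tens (src f) (src g)) (tens (tgt f) (tgt g))
       (\<lambda>n. pair_map (on_cubes f) (on_cubes g)) (sum_map (on_labels f) (on_labels g))"

text \<open>
  The category of extensional HDAs. Its objects are single HDAs over the universe \<open>'a el\<close>, and the
  monoidal unit is the HDA with one (initial and final) vertex, no other cubes and no labels.
\<close>

definition HDA_ext :: "('a el hda, ('a el hda, 'a el) mor) moncat_data" where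
  "HDA_ext =
     \<lparr>Obj = {A. is_hda A \<and> is_extensional A},
      Arr = {f. src f \<in> {A. is_hda A \<and> is_extensional A} \<and>
                tgt f \<in> {A. is_hda A \<and> is_extensional A} \<and> is_hda_mor f},
      Dom = src, Cod = tgt, Id = id_mor, Comp = comp_mor,
      Tens_obj = tensor,
      Tens_arr = tensor_mor tensor,
      Unit = unit_hda,
      Assoc = \<lambda>A B C. mk_mor (tensor (tensor A B) C) (tensor A (tensor B C))
                 (\<lambda>n. assoc_cube) assoc_label,
      Lunit = \<lambda>A. mk_mor (tensor unit_hda A) A (\<lambda>n. pair_snd) from_right,
      Runit = \<lambda>A. mk_mor (tensor A unit_hda) A (\<lambda>n. pair_fst) from_left\<rparr>"

definition TS_ltimes :: "('a el lts, ('a el lts, 'a el) mor) moncat_data" where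
  "TS_ltimes =
     \<lparr>Obj = {T. is_lts T},
      Arr = {f. is_lts (src f) \<and> is_lts (tgt f) \<and> is_lts_mor f},
      Dom = src, Cod = tgt, Id = id_mor, Comp = comp_mor,
      Tens_obj = interleave,
      Tens_arr = tensor_mor interleave,
      Unit = unit_lts,
      Assoc = \<lambda>R S T. mk_mor (interleave (interleave R S) T) (interleave R (interleave S T))
                 (\<lambda>n. assoc_cube) assoc_label,
      Lunit = \<lambda>T. mk_mor (interleave unit_lts T) T (\<lambda>n. pair_snd) from_right,
      Runit = \<lambda>T. mk_mor (interleave T unit_lts) T (\<lambda>n. pair_fst) from_left\<rparr>"


section \<open>The HDA model of a transition system\<close>

text \<open>\<open>entry x k i\<close> is the member \<open>x\<^sub>i\<^sup>k\<close> of a family \<open>x\<close>.\<close>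

primrec entry :: "'a el \<Rightarrow> bool \<Rightarrow> nat \<Rightarrow> 'a el" where
  "entry (Family xs) k i = (if k then snd (xs ! (i - 1)) else fst (xs ! (i - 1)))"

primrec map_family :: "('a el \<Rightarrow> 'a el) \<Rightarrow> 'a el \<Rightarrow> 'a el" where
  "map_family f (Family xs) = Family (map (map_prod f f) xs)"

text \<open>
  \<open>empty_cubes X d n\<close> is the set of empty \<open>n\<close>-cubes in a precubical set with \<open>(n-1)\<close>-cubes \<open>X\<close> and
  boundary operators \<open>d\<close> on them: the families \<open>(x\<^sub>i\<^sup>k)\<close> in \<open>X\<close> with \<open>d\<^sub>i\<^sup>k x\<^sub>j\<^sup>l = d\<^sub>j\<^sub>-\<^sub>1\<^sup>l x\<^sub>i\<^sup>k\<close> for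
  \<open>1 \<le> i < j \<le> n\<close>.
\<close>

definition empty_cubes ::
  "'a el set \<Rightarrow> (bool \<Rightarrow> nat \<Rightarrow> 'a el \<Rightarrow> 'a el) \<Rightarrow> nat \<Rightarrow> 'a el set" where
  "empty_cubes X d n =
     {Family xs | xs. length xs = n \<and> set xs \<subseteq> X \<times> X \<and>
        (\<forall>k l i j. 1 \<le> i \<and> i < j \<and> j \<le> n \<longrightarrow>
           d k i (entry (Family xs) l j) = d l (j - 1) (entry (Family xs) k i))}"

definition independence_squares :: "'a el lts \<Rightarrow> 'a el set" where
  "independence_squares T =
     {x \<in> empty_cubes (Cubes T 1) (face T 1) 2.
        label T (entry x False 2) = label T (entry x True 2) \<and>
        label T (entry x False 1) = label T (entry x True 1) \<and>
        (label T (entry x False 2), label T (entry x False 1)) \<in> ltimes T}"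

definition Psi_obj :: "'a el lts \<Rightarrow> 'a el hda" where
  "Psi_obj T =
     (hda.truncate T)
       \<lparr>Cubes := \<lambda>n. if n \<le> 1 then Cubes T n else if n = 2 then independence_squares T else {},
        face := \<lambda>n k i x. if n \<le> 1 then face T n k i x else entry x k i\<rparr>"

definition Psi ::
  "('a el lts, ('a el lts, 'a el) mor, 'a el hda, ('a el hda, 'a el) mor) functor_data" where
  "Psi =
     \<lparr>map_obj = Psi_obj,
      map_arr = \<lambda>f. mk_mor (Psi_obj (src f)) (Psi_obj (tgt f))
        (\<lambda>n. if n \<le> 1 then on_cubes f n else map_family (on_cubes f 1)) (on_labels f)\<rparr>"

text \<open>
  The 2-coskeleton of a 2-truncated HDA: for \<open>n \<ge> 3\<close>, the \<open>n\<close>-cubes are, recursively, the empty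
  \<open>n\<close>-cubes that can be formed from the \<open>(n-1)\<close>-cubes.
\<close>

definition cosk_face :: "'a el hda \<Rightarrow> nat \<Rightarrow> bool \<Rightarrow> nat \<Rightarrow> 'a el \<Rightarrow> 'a el" where
  "cosk_face A n k i x = (if n \<le> 2 then face A n k i x else entry x k i)"

primrec cosk_cubes :: "'a el hda \<Rightarrow> nat \<Rightarrow> 'a el set" where
  "cosk_cubes A 0 = Cubes A 0"
| "cosk_cubes A (Suc n) =
     (if Suc n \<le> 2 then Cubes A (Suc n) else empty_cubes (cosk_cubes A n) (cosk_face A n) (Suc n))"

primrec cosk_map :: "(nat \<Rightarrow> 'a el \<Rightarrow> 'a el) \<Rightarrow> nat \<Rightarrow> 'a el \<Rightarrow> 'a el" where
  "cosk_map f 0 = f 0"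
| "cosk_map f (Suc n) = (if Suc n \<le> 2 then f (Suc n) else map_family (cosk_map f n))"

definition Gamma2_obj :: "'a el hda \<Rightarrow> 'a el hda" where
  "Gamma2_obj A = A\<lparr>Cubes := cosk_cubes A, face := cosk_face A\<rparr>"

definition Gamma2 ::
  "('a el hda, ('a el hda, 'a el) mor, 'a el hda, ('a el hda, 'a el) mor) functor_data" where
  "Gamma2 =
     \<lparr>map_obj = Gamma2_obj,
      map_arr = \<lambda>f. mk_mor (Gamma2_obj (src f)) (Gamma2_obj (tgt f))
        (cosk_map (on_cubes f)) (on_labels f)\<rparr>"

definition HDA_model ::
  "('a el lts, ('a el lts, 'a el) mor, 'a el hda, ('a el hda, 'a el) mor) functor_data" where
  "HDA_model = functor_comp Gamma2 Psi"

text \<open>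
  \<open>U(\<S> ||| \<T>)\<close> has the same vertices, edges and labels as the tensor product of the models of \<open>\<S>\<close>
  and \<open>\<T>\<close> and as the model of \<open>\<S> ||| \<T>\<close>, so restricting to the identity is literal.
\<close>

definition restricts_to_identity :: "('e hda, 'e) mor \<Rightarrow> 'e hda \<Rightarrow> bool" where
  "restricts_to_identity f X \<longleftrightarrow>
     (\<forall>n. \<forall>x \<in> Cubes X n. on_cubes f n x = x) \<and> (\<forall>a \<in> Labels X. on_labels f a = a)"

definition is_structure_iso ::
  "'a el lts \<Rightarrow> 'a el lts \<Rightarrow> ('a el hda, 'a el) mor \<Rightarrow> bool" where
  "is_structure_iso S T f \<longleftrightarrow>
     is_iso HDA_ext f \<and>
     src f = tensor (map_obj HDA_model S) (map_obj HDA_model T) \<and>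
     tgt f = map_obj HDA_model (interleave S T) \<and>
     restricts_to_identity f (hda.truncate (interleave S T))"

end

(* A morphism into a model A(T) is determined by its values on vertices, edges and labels, because a
   cube of dimension at least 2 of A(T) is the family of its faces. Conversely, a map given in degrees
   at most 1 extends to A(T) as soon as the labels of every 2-cube of its source are related in T.
   It therefore suffices to show that A(S) (x) A(T) has the same filling property as A(S ||| T): every
   admissible empty cube of dimension at least 2 has a unique filler. The facets of an empty n-cube in
   a tensor product have the degrees of the facets of a cube (a, b) with a of degree P and b of degree
   n - P. Their second components over the first P directions coincide and give b, their first
   components over the remaining directions coincide and give a; if one of these sets of directions
   is empty, the missing component is a filler in the corresponding factor. The canonical morphism is
   then bijective in each degree, and all coherence diagrams commute because they do so in degrees at
   most 1. *)

theory Submission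
  imports Defs
begin

section \<open>Higher-dimensional automata and their morphisms\<close>

text \<open>The delicate dimension is 2. The facets of the facets of a square are vertices, which
  have degree 0 in both factors, so the face identities of an empty square in a tensor product carry
  no information about the degrees of its edges. These have to be read off the labels: opposite
  edges have equal labels and hence move in the same factor, and the relation on labels contains no
  pair with a label of the right factor before one of the left factor. This asymmetry of the
  interleaving excludes a square whose two directions come in the wrong order. From dimension 3 on
  the degrees alone determine the shape. A second point is a factor with a single direction. Then
  only two opposite facets carry the other component, and no face identity compares them directly.
  They agree because they have the same faces, which needs uniqueness of fillers in the other factor
  or, if they are edges, extensionality together with their common label.\<close>

lemma is_hdaD:
  assumes "is_hda A"
  shows hda_face: "\<lbrakk>x \<in> Cubes A n; 1 \<le> i; i \<le> n\<rbrakk> \<Longrightarrow> face A n k i x \<in> Cubes A (n - 1)"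
    and hda_face_face: "\<lbrakk>x \<in> Cubes A n; 1 \<le> i; i < j; j \<le> n\<rbrakk> \<Longrightarrow>
      face A (n - 1) k i (face A n l j x) = face A (n - 1) l (j - 1) (face A n k i x)"
    and hda_Init: "Init A \<in> Cubes A 0"
    and hda_Final: "x \<in> Final A \<Longrightarrow> x \<in> Cubes A 0"
    and hda_label: "x \<in> Cubes A 1 \<Longrightarrow> label A x \<in> Labels A"
    and hda_label_face: "\<lbrakk>x \<in> Cubes A 2; i = 1 \<or> i = 2\<rbrakk> \<Longrightarrow>
      label A (face A 2 k i x) = label A (face A 2 l i x)"
proof -
  show "label A (face A 2 k i x) = label A (face A 2 l i x)" if "x \<in> Cubes A 2" "i = 1 \<or> i = 2"
    using assms that unfolding is_hda_def by (cases k; cases l) auto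
qed (use assms in \<open>auto simp: is_hda_def Pi_iff\<close>)

lemma extensionalD:
  assumes "is_extensional A" "x \<in> Cubes A 1" "y \<in> Cubes A 1" "label A x = label A y"
    "\<And>k. face A 1 k 1 x = face A 1 k 1 y"
  shows "x = y"
  using assms unfolding is_extensional_def by blast

lemma is_hda_morD:
  assumes "is_hda_mor f"
  shows mor_cubes: "on_cubes f n \<in> Cubes (src f) n \<rightarrow>\<^sub>E Cubes (tgt f) n"
    and mor_cube: "x \<in> Cubes (src f) n \<Longrightarrow> on_cubes f n x \<in> Cubes (tgt f) n"
    and mor_face: "\<lbrakk>x \<in> Cubes (src f) n; 1 \<le> i; i \<le> n\<rbrakk> \<Longrightarrow>
      on_cubes f (n - 1) (face (src f) n k i x) = face (tgt f) n k i (on_cubes f n x)"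
    and mor_Init: "on_cubes f 0 (Init (src f)) = Init (tgt f)"
    and mor_Final: "x \<in> Final (src f) \<Longrightarrow> on_cubes f 0 x \<in> Final (tgt f)"
    and mor_labels: "on_labels f \<in> Labels (src f) \<rightarrow>\<^sub>E Labels (tgt f)"
    and mor_Label: "a \<in> Labels (src f) \<Longrightarrow> on_labels f a \<in> Labels (tgt f)"
    and mor_label: "x \<in> Cubes (src f) 1 \<Longrightarrow>
      label (tgt f) (on_cubes f 1 x) = on_labels f (label (src f) x)"
proof -
  show "on_cubes f n \<in> Cubes (src f) n \<rightarrow>\<^sub>E Cubes (tgt f) n"
    using assms by (simp add: is_hda_mor_def)
  then show "x \<in> Cubes (src f) n \<Longrightarrow> on_cubes f n x \<in> Cubes (tgt f) n"
    by blast
qed (use assms in \<open>auto simp: is_hda_mor_def\<close>)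

lemma mor_eqI:
  assumes "is_hda_mor f" "is_hda_mor g" "src f = src g" "tgt f = tgt g"
    "\<And>n x. x \<in> Cubes (src f) n \<Longrightarrow> on_cubes f n x = on_cubes g n x"
    "\<And>a. a \<in> Labels (src f) \<Longrightarrow> on_labels f a = on_labels g a"
  shows "f = g"
proof -
  have "on_cubes f n = on_cubes g n" for n
    by (rule PiE_ext[OF mor_cubes[OF assms(1)]])
      (use assms mor_cubes[OF assms(2), of n] in auto)
  moreover have "on_labels f = on_labels g"
    by (rule PiE_ext[OF mor_labels[OF assms(1)]]) (use assms mor_labels[OF assms(2)] in auto)
  ultimately show ?thesis
    using assms by (cases f; cases g) (auto simp: fun_eq_iff)
qed

lemma mk_mor_simps [simp]:
  "src (mk_mor A B f s) = A" "tgt (mk_mor A B f s) = B"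
  "x \<in> Cubes A n \<Longrightarrow> on_cubes (mk_mor A B f s) n x = f n x"
  "a \<in> Labels A \<Longrightarrow> on_labels (mk_mor A B f s) a = s a"
  by (simp_all add: mk_mor_def)

lemma comp_mor_simps [simp]:
  "src (comp_mor g f) = src f" "tgt (comp_mor g f) = tgt g"
  "x \<in> Cubes (src f) n \<Longrightarrow> on_cubes (comp_mor g f) n x = on_cubes g n (on_cubes f n x)"
  "a \<in> Labels (src f) \<Longrightarrow> on_labels (comp_mor g f) a = on_labels g (on_labels f a)"
  by (simp_all add: comp_mor_def)

lemma id_mor_simps [simp]:
  "src (id_mor A) = A" "tgt (id_mor A) = A"
  "x \<in> Cubes A n \<Longrightarrow> on_cubes (id_mor A) n x = x"
  "a \<in> Labels A \<Longrightarrow> on_labels (id_mor A) a = a"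
  by (simp_all add: id_mor_def)

text \<open>\<open>mk_mor\<close> restricts the maps to the cubes and labels of \<open>A\<close>.
  The conditions survive this because \<open>is_hda A\<close> keeps faces, initial and final states
  and labels of edges inside these sets.\<close>

lemma is_hda_mor_mk_mor:
  assumes "is_hda A"
    "\<And>n x. x \<in> Cubes A n \<Longrightarrow> f n x \<in> Cubes B n"
    "\<And>n k i x. \<lbrakk>x \<in> Cubes A n; 1 \<le> i; i \<le> n\<rbrakk> \<Longrightarrow> f (n - 1) (face A n k i x) = face B n k i (f n x)"
    "f 0 (Init A) = Init B"
    "\<And>x. x \<in> Final A \<Longrightarrow> f 0 x \<in> Final B"
    "\<And>a. a \<in> Labels A \<Longrightarrow> s a \<in> Labels B"
    "\<And>x. x \<in> Cubes A 1 \<Longrightarrow> label B (f 1 x) = s (label A x)"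
  shows "is_hda_mor (mk_mor A B f s)"
  unfolding is_hda_mor_def
proof (intro conjI allI ballI impI)
  show "on_cubes (mk_mor A B f s) n
      \<in> Cubes (src (mk_mor A B f s)) n \<rightarrow>\<^sub>E Cubes (tgt (mk_mor A B f s)) n" for n
    using assms(2) by (auto simp: mk_mor_def)
  show "on_labels (mk_mor A B f s)
      \<in> Labels (src (mk_mor A B f s)) \<rightarrow>\<^sub>E Labels (tgt (mk_mor A B f s))"
    using assms(6) by (auto simp: mk_mor_def)
qed (use assms(3-5,7) hda_face[OF assms(1)] hda_Init[OF assms(1)] hda_Final[OF assms(1)]
    hda_label[OF assms(1)] in auto)

lemma is_hda_mor_id: "is_hda A \<Longrightarrow> is_hda_mor (id_mor A)"
  unfolding id_mor_def by (rule is_hda_mor_mk_mor) auto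

lemma is_hda_mor_comp:
  assumes "is_hda (src f)" "is_hda_mor f" "is_hda_mor g" "tgt f = src g"
  shows "is_hda_mor (comp_mor g f)"
  unfolding comp_mor_def
proof (rule is_hda_mor_mk_mor[OF assms(1)])
  note fD = is_hda_morD[OF assms(2)] and gD = is_hda_morD[OF assms(3), folded assms(4)]
  fix n k i x
  assume x: "x \<in> Cubes (src f) n" "1 \<le> i" "i \<le> n"
  then show "(on_cubes g (n - 1) \<circ> on_cubes f (n - 1)) (face (src f) n k i x) =
      face (tgt g) n k i ((on_cubes g n \<circ> on_cubes f n) x)"
    using fD(2,3) gD(3) by simp
qed (use is_hda_morD[OF assms(2)] is_hda_morD[OF assms(3), folded assms(4)] in auto)

text \<open>Bijectivity is not enough: morphisms preserve final states but need not reflect them,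
  hence \<open>fin\<close>. The remaining conditions pass to the inverse by injectivity.\<close>

lemma is_hda_mor_inverse:
  assumes "is_hda (src f)" "is_hda (tgt f)" "is_hda_mor f"
    and bij: "\<And>n. bij_betw (on_cubes f n) (Cubes (src f) n) (Cubes (tgt f) n)"
    and bijL: "bij_betw (on_labels f) (Labels (src f)) (Labels (tgt f))"
    and fin: "Final (tgt f) \<subseteq> on_cubes f 0 ` Final (src f)"
  defines "g \<equiv> mk_mor (tgt f) (src f) (\<lambda>n. inv_into (Cubes (src f) n) (on_cubes f n))
      (inv_into (Labels (src f)) (on_labels f))"
  shows "is_hda_mor g" "comp_mor g f = id_mor (src f)" "comp_mor f g = id_mor (tgt f)"
proof -
  note fD = is_hda_morD[OF assms(3)]
  let ?h = "\<lambda>n. inv_into (Cubes (src f) n) (on_cubes f n)"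
  have h: "?h n y \<in> Cubes (src f) n" "on_cubes f n (?h n y) = y" if "y \<in> Cubes (tgt f) n" for n y
    using bij[of n] that
    by (auto simp: bij_betw_def inv_into_into f_inv_into_f)
  have h': "?h n (on_cubes f n x) = x" if "x \<in> Cubes (src f) n" for n x
    using bij[of n] that by (auto simp: bij_betw_def)
  let ?s = "inv_into (Labels (src f)) (on_labels f)"
  have s: "?s y \<in> Labels (src f)" "on_labels f (?s y) = y" if "y \<in> Labels (tgt f)" for y
    using bijL that by (auto simp: bij_betw_def inv_into_into f_inv_into_f)
  have s': "?s (on_labels f x) = x" if "x \<in> Labels (src f)" for x
    using bijL that by (auto simp: bij_betw_def)
  show g: "is_hda_mor g"
    unfolding g_def
  proof (rule is_hda_mor_mk_mor[OF assms(2)])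
    fix n k i y
    assume y: "y \<in> Cubes (tgt f) n" "1 \<le> i" "i \<le> n"
    then show "?h (n - 1) (face (tgt f) n k i y) = face (src f) n k i (?h n y)"
      by (metis fD(3) h h' hda_face[OF assms(1)])
  next
    show "?h 0 (Init (tgt f)) = Init (src f)"
      by (metis fD(4) h' hda_Init[OF assms(1)])
  next
    show "?h 0 y \<in> Final (src f)" if "y \<in> Final (tgt f)" for y
      using fin that h' hda_Final[OF assms(1)] by force
  next
    show "label (src f) (?h 1 y) = ?s (label (tgt f) y)" if "y \<in> Cubes (tgt f) 1" for y
      by (metis fD(8) h s' hda_label[OF assms(1)] that)
  qed (use h s in auto)
  show "comp_mor g f = id_mor (src f)"
  proof (rule mor_eqI)
    show "is_hda_mor (comp_mor g f)"
      using is_hda_mor_comp[OF assms(1,3) g] by (simp add: g_def)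
    show "is_hda_mor (id_mor (src f))"
      using is_hda_mor_id[OF assms(1)] .
  qed (use h' s' fD in \<open>auto simp: g_def\<close>)
  show "comp_mor f g = id_mor (tgt f)"
  proof (rule mor_eqI)
    show "is_hda_mor (comp_mor f g)"
      using is_hda_mor_comp[OF _ g assms(3)] assms(2) by (simp add: g_def)
    show "is_hda_mor (id_mor (tgt f))"
      using is_hda_mor_id[OF assms(2)] .
  qed (use h s fD in \<open>auto simp: g_def\<close>)
qed

section \<open>Monoidal categories of automata\<close>

text \<open>The condition that \<open>is_lts_mor\<close> adds to \<open>is_hda_mor\<close>, with the
  relation as a parameter. For the empty relation it is vacuous, which covers HDAs.\<close>

definition preserves :: "(('e, 'm) hda_scheme \<Rightarrow> ('e \<times> 'e) set) \<Rightarrow> (('e, 'm) hda_scheme, 'e) mor \<Rightarrow> bool"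
  where "preserves rel f \<longleftrightarrow> (\<forall>(a, b) \<in> rel (src f). (on_labels f a, on_labels f b) \<in> rel (tgt f))"

lemma preservesI:
  "(\<And>a b. (a, b) \<in> rel (src f) \<Longrightarrow> (on_labels f a, on_labels f b) \<in> rel (tgt f)) \<Longrightarrow> preserves rel f"
  by (auto simp: preserves_def)

lemma preservesD:
  "preserves rel f \<Longrightarrow> (a, b) \<in> rel (src f) \<Longrightarrow> (on_labels f a, on_labels f b) \<in> rel (tgt f)"
  by (auto simp: preserves_def)

fun assoc_cube_inv :: "'a el \<Rightarrow> 'a el" where
  "assoc_cube_inv (Pair p x s (Pair q y r z)) = Pair (p + q) (Pair p x q y) r z"

fun assoc_label_inv :: "'a el \<Rightarrow> 'a el" where
  "assoc_label_inv (Left a) = Left (Left a)"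
| "assoc_label_inv (Right (Left a)) = Left (Right a)"
| "assoc_label_inv (Right (Right a)) = Right a"

text \<open>
  HDAs and \<open>\<ltimes>\<close>-transition systems are treated uniformly: \<open>low\<close> is the set of degrees in which cubes
  may exist, \<open>rel\<close> is the relation on labels (empty for HDAs), and \<open>cross\<close> tells whether the labels
  of the left factor of a tensor product are related to those of the right factor.
\<close>

locale tensor_structure =
  fixes tens :: "('a el, 'm) hda_scheme \<Rightarrow> ('a el, 'm) hda_scheme \<Rightarrow> ('a el, 'm) hda_scheme"
    and unt :: "('a el, 'm) hda_scheme"
    and rel :: "('a el, 'm) hda_scheme \<Rightarrow> ('a el \<times> 'a el) set"
    and low :: "nat \<Rightarrow> bool"
    and cross :: bool
  assumes low_0: "low 0"
    and low_mono: "low n \<Longrightarrow> m \<le> n \<Longrightarrow> low m"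
    and Cubes_tens: "Cubes (tens A B) n = (if low n
      then {Pair p x q y | p x q y. p + q = n \<and> x \<in> Cubes A p \<and> y \<in> Cubes B q} else {})"
    and face_tens: "face (tens A B) n k i (Pair p x q y) =
      (if i \<le> p then Pair (p - 1) (face A p k i x) q y
       else Pair p x (q - 1) (face B q k (i - p) y))"
    and Init_tens: "Init (tens A B) = Pair 0 (Init A) 0 (Init B)"
    and Final_tens: "Final (tens A B) = {Pair 0 x 0 y | x y. x \<in> Final A \<and> y \<in> Final B}"
    and Labels_tens: "Labels (tens A B) = Left ` Labels A \<union> Right ` Labels B"
    and label_tens: "label (tens A B) (Pair p x q y) =
      (if p = 1 then Left (label A x) else Right (label B y))"
    and rel_tens: "rel (tens A B) =
      {(Left a, Left b) | a b. (a, b) \<in> rel A} \<union> {(Right a, Right b) | a b. (a, b) \<in> rel B} \<union>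
      (if cross then {(Left a, Right b) | a b. a \<in> Labels A \<and> b \<in> Labels B} else {})"
    and Cubes_unt: "Cubes unt n = (if n = 0 then {Point} else {})"
    and Init_unt: "Init unt = Point"
    and Final_unt: "Final unt = {Point}"
    and Labels_unt: "Labels unt = {}"
    and rel_unt: "rel unt = {}"
begin

text \<open>One notion of object for both categories: the condition on \<open>low\<close> expresses
  truncation, and that on \<open>rel\<close> is the inclusion required by
  \<open>is_lts\<close>.\<close>

definition ok :: "('a el, 'm) hda_scheme \<Rightarrow> bool" where
  "ok A \<longleftrightarrow> is_hda A \<and> is_extensional A \<and> (\<forall>n. \<not> low n \<longrightarrow> Cubes A n = {}) \<and>
     rel A \<subseteq> Labels A \<times> Labels A"

lemma okD:
  assumes "ok A"
  shows "is_hda A" "is_extensional A" "x \<in> Cubes A n \<Longrightarrow> low n"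
    "(a, b) \<in> rel A \<Longrightarrow> a \<in> Labels A \<and> b \<in> Labels A"
  using assms by (auto simp: ok_def)

abbreviation assoc_mor where
  "assoc_mor A B C \<equiv> mk_mor (tens (tens A B) C) (tens A (tens B C)) (\<lambda>n. assoc_cube) assoc_label"

abbreviation lunit_mor where
  "lunit_mor A \<equiv> mk_mor (tens unt A) A (\<lambda>n. pair_snd) from_right"

abbreviation runit_mor where
  "runit_mor A \<equiv> mk_mor (tens A unt) A (\<lambda>n. pair_fst) from_left"

text \<open>Built so that \<open>HDA_ext\<close> and \<open>TS_ltimes\<close> are instances by plain
  equality, see \<open>HDA_ext_eq\<close> and \<open>TS_ltimes_eq\<close>.\<close>

definition moncat :: "(('a el, 'm) hda_scheme, (('a el, 'm) hda_scheme, 'a el) mor) moncat_data" where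
  "moncat =
     \<lparr>Obj = {A. ok A},
      Arr = {f. ok (src f) \<and> ok (tgt f) \<and> is_hda_mor f \<and> preserves rel f},
      Dom = src, Cod = tgt, Id = id_mor, Comp = comp_mor,
      Tens_obj = tens, Tens_arr = tensor_mor tens, Unit = unt,
      Assoc = assoc_mor, Lunit = lunit_mor, Runit = runit_mor\<rparr>"

lemma moncat_simps [simp]:
  "Obj moncat = {A. ok A}" "Dom moncat = src" "Cod moncat = tgt" "Id moncat = id_mor"
  "Comp moncat = comp_mor" "Tens_obj moncat = tens" "Tens_arr moncat = tensor_mor tens"
  "Unit moncat = unt" "Assoc moncat = assoc_mor" "Lunit moncat = lunit_mor"
  "Runit moncat = runit_mor"
  by (simp_all add: moncat_def)

lemma Hom_moncat:
  "f \<in> Hom moncat A B \<longleftrightarrow>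
     src f = A \<and> tgt f = B \<and> ok A \<and> ok B \<and> is_hda_mor f \<and> preserves rel f"
  by (auto simp: Hom_def moncat_def)

lemma HomD:
  assumes "f \<in> Hom moncat A B"
  shows "src f = A" "tgt f = B" "ok A" "ok B" "is_hda_mor f" "preserves rel f"
    "x \<in> Cubes A n \<Longrightarrow> on_cubes f n x \<in> Cubes B n"
    "a \<in> Labels A \<Longrightarrow> on_labels f a \<in> Labels B"
    "(a, b) \<in> rel A \<Longrightarrow> (on_labels f a, on_labels f b) \<in> rel B"
  using assms mor_cube[of f] mor_Label[of f] preservesD[of rel f] by (auto simp: Hom_moncat)

lemma Hom_eqI:
  assumes "f \<in> Hom moncat A B" "g \<in> Hom moncat A B"
    "\<And>n x. x \<in> Cubes A n \<Longrightarrow> on_cubes f n x = on_cubes g n x"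
    "\<And>a. a \<in> Labels A \<Longrightarrow> on_labels f a = on_labels g a"
  shows "f = g"
  using assms by (intro mor_eqI) (auto simp: Hom_moncat)

lemma mk_mor_Hom:
  assumes "ok A" "ok B"
    "\<And>n x. x \<in> Cubes A n \<Longrightarrow> f n x \<in> Cubes B n"
    "\<And>n k i x. \<lbrakk>x \<in> Cubes A n; 1 \<le> i; i \<le> n\<rbrakk> \<Longrightarrow> f (n - 1) (face A n k i x) = face B n k i (f n x)"
    "f 0 (Init A) = Init B"
    "\<And>x. x \<in> Final A \<Longrightarrow> f 0 x \<in> Final B"
    "\<And>a. a \<in> Labels A \<Longrightarrow> s a \<in> Labels B"
    "\<And>x. x \<in> Cubes A 1 \<Longrightarrow> label B (f 1 x) = s (label A x)"
    "\<And>a b. (a, b) \<in> rel A \<Longrightarrow> (s a, s b) \<in> rel B"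
  shows "mk_mor A B f s \<in> Hom moncat A B"
proof -
  have "is_hda_mor (mk_mor A B f s)"
    using assms okD(1)[OF assms(1)] by (intro is_hda_mor_mk_mor) auto
  moreover have "preserves rel (mk_mor A B f s)"
    by (rule preservesI) (use assms(9) okD(4)[OF assms(1)] in auto)
  ultimately show ?thesis
    using assms by (simp add: Hom_moncat)
qed

lemma id_Hom: "ok A \<Longrightarrow> id_mor A \<in> Hom moncat A A"
  unfolding id_mor_def by (rule mk_mor_Hom) auto

lemma comp_Hom:
  assumes "f \<in> Hom moncat A B" "g \<in> Hom moncat B C"
  shows "comp_mor g f \<in> Hom moncat A C"
proof -
  have "is_hda_mor (comp_mor g f)"
    using is_hda_mor_comp[of f g] HomD[OF assms(1)] HomD[OF assms(2)] okD(1) by auto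
  moreover have "preserves rel (comp_mor g f)"
    by (rule preservesI) (use okD(4)[of A] HomD[OF assms(1)] HomD[OF assms(2)] in auto)
  ultimately show ?thesis
    using assms by (simp add: Hom_moncat)
qed

lemma category_moncat: "category moncat"
proof
  fix f A B assume f: "f \<in> Hom moncat A B"
  note fD = HomD[OF f]
  show "Comp moncat (Id moncat B) f = f"
    using comp_Hom[OF f id_Hom] fD by (auto intro!: Hom_eqI[OF _ f])
  show "Comp moncat f (Id moncat A) = f"
    using comp_Hom[OF id_Hom f] fD by (auto intro!: Hom_eqI[OF _ f])
next
  fix f g h A B C D
  assume f: "f \<in> Hom moncat A B" and g: "g \<in> Hom moncat B C" and h: "h \<in> Hom moncat C D"
  show "Comp moncat h (Comp moncat g f) = Comp moncat (Comp moncat h g) f"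
    using comp_Hom[OF comp_Hom[OF f g] h] comp_Hom[OF f comp_Hom[OF g h]] HomD[OF f] HomD[OF g]
    by (auto intro!: Hom_eqI)
qed (use id_Hom comp_Hom in \<open>auto simp: moncat_def Hom_def\<close>)

text \<open>For the inverse to be a morphism, the relation has to be reflected as well as the final
  states; hence \<open>refl\<close> next to \<open>fin\<close>.\<close>

lemma is_iso_moncatI:
  assumes f: "f \<in> Hom moncat A B"
    and bij: "\<And>n. bij_betw (on_cubes f n) (Cubes A n) (Cubes B n)"
    and bijL: "bij_betw (on_labels f) (Labels A) (Labels B)"
    and fin: "Final B \<subseteq> on_cubes f 0 ` Final A"
    and refl: "\<And>a b. \<lbrakk>a \<in> Labels A; b \<in> Labels A; (on_labels f a, on_labels f b) \<in> rel B\<rbrakk>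
      \<Longrightarrow> (a, b) \<in> rel A"
  shows "is_iso moncat f"
proof -
  note fD = HomD[OF f]
  let ?g = "mk_mor B A (\<lambda>n. inv_into (Cubes A n) (on_cubes f n)) (inv_into (Labels A) (on_labels f))"
  have inv: "is_hda_mor ?g" "comp_mor ?g f = id_mor A" "comp_mor f ?g = id_mor B"
    using is_hda_mor_inverse[of f] fD okD(1) bij bijL fin by auto
  have "preserves rel ?g"
  proof (rule preservesI)
    fix a b
    assume ab: "(a, b) \<in> rel (src ?g)"
    then have "a \<in> Labels B" "b \<in> Labels B"
      using okD(4)[OF fD(4)] by auto
    then show "(on_labels ?g a, on_labels ?g b) \<in> rel (tgt ?g)"
      using ab bijL by (auto intro!: refl simp: bij_betw_def inv_into_into f_inv_into_f)
  qed
  then have "?g \<in> Hom moncat B A"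
    using inv fD by (simp add: Hom_moncat)
  then show ?thesis
    using f inv fD unfolding is_iso_def by (auto simp: Hom_def)
qed

text \<open>For maps whose inverse is given by formulas. \<open>g\<close> and \<open>t\<close> only
  witness bijectivity and the reflection of final states and of the relation, so their compatibility
  with faces never has to be checked.\<close>

lemma is_iso_mk_morI:
  assumes f: "mk_mor A B f s \<in> Hom moncat A B"
    and "\<And>n x. x \<in> Cubes A n \<Longrightarrow> g n (f n x) = x"
    "\<And>n y. y \<in> Cubes B n \<Longrightarrow> g n y \<in> Cubes A n \<and> f n (g n y) = y"
    "\<And>y. y \<in> Final B \<Longrightarrow> g 0 y \<in> Final A"
    "\<And>a. a \<in> Labels A \<Longrightarrow> t (s a) = a"
    "\<And>b. b \<in> Labels B \<Longrightarrow> t b \<in> Labels A \<and> s (t b) = b"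
    and tm: "\<And>a b. (a, b) \<in> rel B \<Longrightarrow> (t a, t b) \<in> rel A"
  shows "is_iso moncat (mk_mor A B f s)"
proof (rule is_iso_moncatI[OF f])
  note fD = HomD[OF f]
  show "bij_betw (on_cubes (mk_mor A B f s) n) (Cubes A n) (Cubes B n)" for n
    by (rule bij_betw_byWitness[where f' = "g n"]) (use assms(2,3) fD(7) in auto)
  show "bij_betw (on_labels (mk_mor A B f s)) (Labels A) (Labels B)"
    by (rule bij_betw_byWitness[where f' = t]) (use assms(5,6) fD(8) in auto)
  show "Final B \<subseteq> on_cubes (mk_mor A B f s) 0 ` Final A"
  proof
    fix y
    assume y: "y \<in> Final B"
    then have "y \<in> Cubes B 0"
      by (rule hda_Final[OF okD(1)[OF fD(4)]])
    then have "y = on_cubes (mk_mor A B f s) 0 (g 0 y)"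
      using assms(3) by simp
    then show "y \<in> on_cubes (mk_mor A B f s) 0 ` Final A"
      using assms(4)[OF y] by blast
  qed
  show "(a, b) \<in> rel A" if "a \<in> Labels A" "b \<in> Labels A"
    "(on_labels (mk_mor A B f s) a, on_labels (mk_mor A B f s) b) \<in> rel B" for a b
    using that tm[of "s a" "s b"] assms(5) by auto
qed

section \<open>Tensor product of objects and of morphisms\<close>

lemma tens_ok:
  assumes "ok A" "ok B"
  shows "ok (tens A B)"
proof -
  note A = okD[OF assms(1)] and B = okD[OF assms(2)]
  note hA = is_hdaD[OF A(1)] and hB = is_hdaD[OF B(1)]
  have "is_hda (tens A B)"
    unfolding is_hda_def
  proof (intro conjI allI ballI impI)
    fix n :: nat and k i
    assume i: "1 \<le> i \<and> i \<le> n"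
    show "face (tens A B) n k i \<in> Cubes (tens A B) n \<rightarrow> Cubes (tens A B) (n - 1)"
    proof
      fix x
      assume "x \<in> Cubes (tens A B) n"
      then obtain p a q b where x: "x = Pair p a q b" "p + q = n" "a \<in> Cubes A p" "b \<in> Cubes B q"
        and n: "low n" by (auto simp: Cubes_tens split: if_splits)
      then show "face (tens A B) n k i x \<in> Cubes (tens A B) (n - 1)"
        using hA(1)[OF x(3), of i] hB(1)[OF x(4), of "i - p"] low_mono[OF n, of "n - 1"] i
        by (auto simp: Cubes_tens face_tens)
    qed
  next
    fix n k l i j x
    assume x: "x \<in> Cubes (tens A B) n" and ij: "1 \<le> i \<and> i < j \<and> j \<le> n"
    then obtain p a q b where x: "x = Pair p a q b" "p + q = n" "a \<in> Cubes A p" "b \<in> Cubes B q"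
      by (auto simp: Cubes_tens split: if_splits)
    \<comment> \<open>Both directions in the left factor, one in each, or both in the right factor.
      In the mixed case the two face maps act on different components.\<close>
    consider "j \<le> p" | "i \<le> p" "p < j" | "p < i"
      by linarith
    then show "face (tens A B) (n - 1) k i (face (tens A B) n l j x) =
        face (tens A B) (n - 1) l (j - 1) (face (tens A B) n k i x)"
    proof cases
      case 1
      then show ?thesis
        using hA(2)[OF x(3), of i j] ij by (auto simp: x face_tens)
    next
      case 2
      then show ?thesis
        using ij by (auto simp: x face_tens)
    next
      case 3
      then show ?thesis
        using hB(2)[OF x(4), of "i - p" "j - p" k l] ij x(2) by (auto simp: x(1) face_tens)
    qed
  next
    fix x i
    assume "x \<in> Cubes (tens A B) 2" and i: "i \<in> {1, 2 :: nat}"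
    then obtain p a q b where x: "x = Pair p a q b" "p + q = 2" "a \<in> Cubes A p" "b \<in> Cubes B q"
      by (auto simp: Cubes_tens split: if_splits)
    then consider "p = 0" "q = 2" | "p = 1" "q = 1" | "p = 2" "q = 0"
      by linarith
    then show "label (tens A B) (face (tens A B) 2 False i x) =
        label (tens A B) (face (tens A B) 2 True i x)"
      using hA(6)[of a i] hB(6)[of b i] i x by cases (auto simp: face_tens label_tens)
  qed (use low_0 hA hB in \<open>auto simp: Cubes_tens Init_tens Final_tens Labels_tens label_tens
      add_is_1 split: if_splits\<close>)
  moreover have "is_extensional (tens A B)"
    unfolding is_extensional_def
  proof (intro ballI impI)
    fix x y
    assume xy: "x \<in> Cubes (tens A B) 1" "y \<in> Cubes (tens A B) 1"
      "label (tens A B) x = label (tens A B) y \<and>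
       face (tens A B) 1 False 1 x = face (tens A B) 1 False 1 y \<and>
       face (tens A B) 1 True 1 x = face (tens A B) 1 True 1 y"
    obtain p a q b where x: "x = Pair p a q b" "p + q = 1" "a \<in> Cubes A p" "b \<in> Cubes B q"
      using xy(1) by (auto simp: Cubes_tens split: if_splits)
    obtain p' a' q' b' where y: "y = Pair p' a' q' b'" "p' + q' = 1" "a' \<in> Cubes A p'" "b' \<in> Cubes B q'"
      using xy(2) by (auto simp: Cubes_tens split: if_splits)
    have eq: "label (tens A B) x = label (tens A B) y"
      "\<And>k. face (tens A B) 1 k 1 x = face (tens A B) 1 k 1 y"
      using xy(3) by auto (metis (full_types))
    show "x = y"
    \<comment> \<open>The injection \<open>Left\<close> or \<open>Right\<close> on the common label
      shows in which factor both edges move; the other components are vertices, and they agree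
      because they occur in the faces.\<close>
    proof (cases "p = 1")
      case True
      then have "p' = 1" "q = 0" "q' = 0"
        using eq(1) x y by (auto simp: label_tens split: if_splits)
      then show ?thesis
        using eq x y True extensionalD[OF A(2), of a a'] by (simp add: face_tens label_tens)
    next
      case False
      then have "p = 0" "p' = 0" "q = 1" "q' = 1"
        using eq(1) x y by (auto simp: label_tens split: if_splits)
      then show ?thesis
        using eq x y extensionalD[OF B(2), of b b'] by (simp add: face_tens label_tens)
    qed
  qed
  moreover have "rel (tens A B) \<subseteq> Labels (tens A B) \<times> Labels (tens A B)"
    using A(4) B(4) by (auto simp: rel_tens Labels_tens split: if_splits)
  ultimately show ?thesis
    by (simp add: ok_def Cubes_tens)
qed

lemma unt_ok: "ok unt"
  unfolding ok_def is_hda_def is_extensional_def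
  by (auto simp: Cubes_unt Init_unt Final_unt rel_unt low_0)

lemma tensor_mor_simps [simp]:
  "src (tensor_mor tens f g) = tens (src f) (src g)"
  "tgt (tensor_mor tens f g) = tens (tgt f) (tgt g)"
  "Pair p x q y \<in> Cubes (tens (src f) (src g)) n \<Longrightarrow>
    on_cubes (tensor_mor tens f g) n (Pair p x q y) = Pair p (on_cubes f p x) q (on_cubes g q y)"
  "a \<in> Labels (src f) \<Longrightarrow> on_labels (tensor_mor tens f g) (Left a) = Left (on_labels f a)"
  "b \<in> Labels (src g) \<Longrightarrow> on_labels (tensor_mor tens f g) (Right b) = Right (on_labels g b)"
  by (simp_all add: tensor_mor_def Labels_tens)

lemma tens_Hom:
  assumes f: "f \<in> Hom moncat A A'" and g: "g \<in> Hom moncat B B'"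
  shows "tensor_mor tens f g \<in> Hom moncat (tens A B) (tens A' B')"
proof -
  note fD = HomD[OF f] and gD = HomD[OF g]
  note f' = is_hda_morD[OF fD(5), unfolded fD(1,2)] and g' = is_hda_morD[OF gD(5), unfolded gD(1,2)]
  show ?thesis
    unfolding tensor_mor_def fD gD
  proof (rule mk_mor_Hom)
    fix n k i x
    assume i: "1 \<le> i" "i \<le> n" and "x \<in> Cubes (tens A B) n"
    then obtain p a q b where x: "x = Pair p a q b" "p + q = n" "a \<in> Cubes A p" "b \<in> Cubes B q"
      by (auto simp: Cubes_tens split: if_splits)
    then show "pair_map (on_cubes f) (on_cubes g) (face (tens A B) n k i x) =
        face (tens A' B') n k i (pair_map (on_cubes f) (on_cubes g) x)"
      using f'(3)[OF x(3), of i] g'(3)[OF x(4), of "i - p"] i by (auto simp: face_tens)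
  qed (use tens_ok fD gD f' g' in \<open>auto simp: Cubes_tens Init_tens Final_tens Labels_tens label_tens
      rel_tens add_is_1 split: if_splits\<close>)
qed

section \<open>Associator and unitors\<close>

lemma assoc_Hom:
  assumes "ok A" "ok B" "ok C"
  shows "assoc_mor A B C \<in> Hom moncat (tens (tens A B) C) (tens A (tens B C))"
proof (rule mk_mor_Hom)
  fix n x
  assume "x \<in> Cubes (tens (tens A B) C) n"
  then obtain p a q b r c where x: "x = Pair (p + q) (Pair p a q b) r c" "p + q + r = n"
    "a \<in> Cubes A p" "b \<in> Cubes B q" "c \<in> Cubes C r" and n: "low n"
    by (auto simp: Cubes_tens split: if_splits)
  \<comment> \<open>Membership in the inner tensor product requires \<open>low (q + r)\<close>,
    which follows from \<open>low n\<close> because \<open>low\<close> is closed downwards.\<close>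
  then show "assoc_cube x \<in> Cubes (tens A (tens B C)) n"
    using low_mono[OF n, of "q + r"] by (auto simp: Cubes_tens)
  fix k i
  assume "1 \<le> i" "i \<le> n"
  then show "assoc_cube (face (tens (tens A B) C) n k i x) = face (tens A (tens B C)) n k i (assoc_cube x)"
    using x(2) by (auto simp: x(1) face_tens)
next
  fix x
  assume "x \<in> Cubes (tens (tens A B) C) 1"
  then show "label (tens A (tens B C)) (assoc_cube x) = assoc_label (label (tens (tens A B) C) x)"
    by (auto simp: Cubes_tens label_tens add_is_1 split: if_splits)
qed (use assms tens_ok in \<open>auto simp: Init_tens Final_tens Labels_tens rel_tens split: if_splits\<close>)

lemma assoc_iso:
  assumes "ok A" "ok B" "ok C"
  shows "is_iso moncat (assoc_mor A B C)"
proof (rule is_iso_mk_morI[OF assoc_Hom[OF assms],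
      where g = "\<lambda>n. assoc_cube_inv" and t = assoc_label_inv])
  fix n y
  assume "y \<in> Cubes (tens A (tens B C)) n"
  then obtain p a q b r c where y: "y = Pair p a (q + r) (Pair q b r c)" "p + q + r = n"
    "a \<in> Cubes A p" "b \<in> Cubes B q" "c \<in> Cubes C r" and n: "low n"
    by (auto simp: Cubes_tens split: if_splits)
  then show "assoc_cube_inv y \<in> Cubes (tens (tens A B) C) n \<and> assoc_cube (assoc_cube_inv y) = y"
    using low_mono[OF n, of "p + q"] by (auto simp: Cubes_tens)
qed (auto simp: Cubes_tens Final_tens Labels_tens rel_tens split: if_splits)

lemma lunit_Hom:
  assumes "ok A"
  shows "lunit_mor A \<in> Hom moncat (tens unt A) A"
  by (rule mk_mor_Hom)
    (use assms tens_ok unt_ok in \<open>auto simp: Cubes_tens Cubes_unt face_tens label_tens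
      Labels_unt rel_unt Init_tens Final_tens Labels_tens rel_tens split: if_splits\<close>)

lemma lunit_iso:
  assumes "ok A"
  shows "is_iso moncat (lunit_mor A)"
  by (rule is_iso_mk_morI[OF lunit_Hom[OF assms],
      where g = "\<lambda>n. Pair 0 Point n" and t = Right])
    (use okD[OF assms] in \<open>auto simp: Cubes_tens Cubes_unt face_tens label_tens
      Final_unt Labels_unt rel_unt Init_tens Final_tens Labels_tens rel_tens split: if_splits\<close>)

lemma runit_Hom:
  assumes "ok A"
  shows "runit_mor A \<in> Hom moncat (tens A unt) A"
  by (rule mk_mor_Hom)
    (use assms tens_ok unt_ok in \<open>auto simp: Cubes_tens Cubes_unt face_tens label_tens
      Labels_unt rel_unt Init_tens Final_tens Labels_tens rel_tens split: if_splits\<close>)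

lemma runit_iso:
  assumes "ok A"
  shows "is_iso moncat (runit_mor A)"
  by (rule is_iso_mk_morI[OF runit_Hom[OF assms],
      where g = "\<lambda>n x. Pair n x 0 Point" and t = Left])
    (use okD[OF assms] in \<open>auto simp: Cubes_tens Cubes_unt face_tens label_tens
      Final_unt Labels_unt rel_unt Init_tens Final_tens Labels_tens rel_tens split: if_splits\<close>)

section \<open>Functoriality of the tensor product, naturality and coherence\<close>

lemma tens_id: "ok A \<Longrightarrow> ok B \<Longrightarrow> tensor_mor tens (id_mor A) (id_mor B) = id_mor (tens A B)"
  by (rule Hom_eqI[OF tens_Hom[OF id_Hom id_Hom] id_Hom])
    (auto simp: tens_ok Cubes_tens Labels_tens split: if_splits)

lemma tens_comp:
  assumes "f \<in> Hom moncat A A'" "f' \<in> Hom moncat A' A''" "g \<in> Hom moncat B B'" "g' \<in> Hom moncat B' B''"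
  shows "tensor_mor tens (comp_mor f' f) (comp_mor g' g) =
    comp_mor (tensor_mor tens f' g') (tensor_mor tens f g)"
  by (rule Hom_eqI[OF tens_Hom[OF comp_Hom[OF assms(1,2)] comp_Hom[OF assms(3,4)]]
        comp_Hom[OF tens_Hom[OF assms(1,3)] tens_Hom[OF assms(2,4)]]])
    (use assms[THEN HomD(1)] assms[THEN HomD(7)] assms[THEN HomD(8)]
     in \<open>auto simp: Cubes_tens Labels_tens split: if_splits\<close>)

lemma assoc_natural:
  assumes "f \<in> Hom moncat A A'" "g \<in> Hom moncat B B'" "h \<in> Hom moncat C C'"
  shows "comp_mor (assoc_mor A' B' C') (tensor_mor tens (tensor_mor tens f g) h) =
    comp_mor (tensor_mor tens f (tensor_mor tens g h)) (assoc_mor A B C)"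
proof (rule Hom_eqI[OF comp_Hom[OF tens_Hom[OF tens_Hom[OF assms(1,2)] assms(3)]]
        comp_Hom[OF assoc_Hom tens_Hom[OF assms(1) tens_Hom[OF assms(2,3)]]]])
  fix n x
  assume x: "x \<in> Cubes (tens (tens A B) C) n"
  \<comment> \<open>A restricted map can be evaluated only at a cube of its source, so the degree of
    every inner tensor product met on the way has to be \<open>low\<close>.\<close>
  then have "low m" if "m \<le> n" for m
    using low_mono that by (auto simp: Cubes_tens split: if_splits)
  with x show "on_cubes (comp_mor (assoc_mor A' B' C') (tensor_mor tens (tensor_mor tens f g) h)) n x =
      on_cubes (comp_mor (tensor_mor tens f (tensor_mor tens g h)) (assoc_mor A B C)) n x"
    using assms[THEN HomD(1)] assms[THEN HomD(2)] assms[THEN HomD(7)]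
    by (auto simp: Cubes_tens split: if_splits)
qed (use assms[THEN HomD(1)] assms[THEN HomD(2)] assms[THEN HomD(3)] assms[THEN HomD(4)]
     assms[THEN HomD(8)] assoc_Hom in \<open>auto simp: Labels_tens\<close>)

lemma lunit_natural:
  assumes "f \<in> Hom moncat A A'"
  shows "comp_mor (lunit_mor A') (tensor_mor tens (id_mor unt) f) = comp_mor f (lunit_mor A)"
  by (rule Hom_eqI[OF comp_Hom[OF tens_Hom[OF id_Hom assms] lunit_Hom]
        comp_Hom[OF lunit_Hom assms]])
    (use HomD[OF assms] unt_ok in \<open>auto simp: Cubes_tens Cubes_unt Labels_tens Labels_unt split: if_splits\<close>)

lemma runit_natural:
  assumes "f \<in> Hom moncat A A'"
  shows "comp_mor (runit_mor A') (tensor_mor tens f (id_mor unt)) = comp_mor f (runit_mor A)"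
  by (rule Hom_eqI[OF comp_Hom[OF tens_Hom[OF assms id_Hom] runit_Hom]
        comp_Hom[OF runit_Hom assms]])
    (use HomD[OF assms] unt_ok in \<open>auto simp: Cubes_tens Cubes_unt Labels_tens Labels_unt split: if_splits\<close>)

lemma pentagon:
  assumes "ok A" "ok B" "ok C" "ok D"
  shows "comp_mor (assoc_mor A B (tens C D)) (assoc_mor (tens A B) C D) =
    comp_mor (tensor_mor tens (id_mor A) (assoc_mor B C D))
      (comp_mor (assoc_mor A (tens B C) D) (tensor_mor tens (assoc_mor A B C) (id_mor D)))"
proof (rule Hom_eqI[OF comp_Hom[OF assoc_Hom assoc_Hom]
        comp_Hom[OF comp_Hom[OF tens_Hom[OF assoc_Hom id_Hom] assoc_Hom] tens_Hom[OF id_Hom assoc_Hom]]])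
  fix n x
  assume x: "x \<in> Cubes (tens (tens (tens A B) C) D) n"
  then have "low m" if "m \<le> n" for m
    using low_mono that by (auto simp: Cubes_tens split: if_splits)
  with x show "on_cubes (comp_mor (assoc_mor A B (tens C D)) (assoc_mor (tens A B) C D)) n x =
    on_cubes (comp_mor (tensor_mor tens (id_mor A) (assoc_mor B C D))
      (comp_mor (assoc_mor A (tens B C) D) (tensor_mor tens (assoc_mor A B C) (id_mor D)))) n x"
    by (auto simp: Cubes_tens split: if_splits)
qed (use assms tens_ok in \<open>auto simp: Labels_tens\<close>)

lemma triangle:
  assumes "ok A" "ok B"
  shows "comp_mor (tensor_mor tens (id_mor A) (lunit_mor B)) (assoc_mor A unt B) =
    tensor_mor tens (runit_mor A) (id_mor B)"
proof (rule Hom_eqI[OF comp_Hom[OF assoc_Hom tens_Hom[OF id_Hom lunit_Hom]]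
        tens_Hom[OF runit_Hom id_Hom]])
  fix n x
  assume x: "x \<in> Cubes (tens (tens A unt) B) n"
  then have "low m" if "m \<le> n" for m
    using low_mono that by (auto simp: Cubes_tens split: if_splits)
  with x show "on_cubes (comp_mor (tensor_mor tens (id_mor A) (lunit_mor B)) (assoc_mor A unt B)) n x =
      on_cubes (tensor_mor tens (runit_mor A) (id_mor B)) n x"
    by (auto simp: Cubes_tens Cubes_unt split: if_splits)
qed (use assms tens_ok unt_ok in \<open>auto simp: Labels_tens Labels_unt\<close>)

lemma monoidal_category_moncat: "monoidal_category moncat"
  by (intro monoidal_category.intro category_moncat monoidal_category_axioms.intro)
    (simp_all only: moncat_simps mem_Collect_eq tens_ok tens_Hom tens_id tens_comp unt_ok
      assoc_Hom assoc_iso assoc_natural lunit_Hom lunit_iso lunit_natural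
      runit_Hom runit_iso runit_natural pentagon triangle)

end

section \<open>Extensional HDAs and \<ltimes>-transition systems as instances\<close>

interpretation HDA: tensor_structure tensor unit_hda "\<lambda>_. {}" "\<lambda>_. True" False
  by standard (auto simp: tensor_def unit_hda_def)

interpretation TS: tensor_structure interleave unit_lts ltimes "\<lambda>n. n < 2" True
  by standard (auto simp: interleave_def unit_lts_def tensor_def unit_hda_def skeleton_def
      hda.defs lts.defs)

lemma HDA_ext_eq: "HDA_ext = HDA.moncat"
  by (auto simp: HDA_ext_def HDA.moncat_def HDA.ok_def preserves_def)

lemma ok_TS: "TS.ok T \<longleftrightarrow> is_lts T"
  unfolding TS.ok_def is_lts_def is_transition_system_def is_truncated_def
  by (auto simp: not_less numeral_2_eq_2 Suc_le_eq)

lemma TS_ltimes_eq: "TS_ltimes = TS.moncat"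
  by (auto simp: TS_ltimes_def TS.moncat_def ok_TS is_lts_mor_def preserves_def)

lemma ok_HDA: "HDA.ok A \<longleftrightarrow> is_hda A \<and> is_extensional A"
  by (simp add: HDA.ok_def)

lemma preserves_empty [simp]: "preserves (\<lambda>_. {}) f"
  by (simp add: preserves_def)

section \<open>Fillings of empty cubes\<close>

definition is_family :: "nat \<Rightarrow> 'a el \<Rightarrow> bool" where
  "is_family n x \<longleftrightarrow> (\<exists>xs. x = Family xs \<and> length xs = n)"

definition family :: "nat \<Rightarrow> (bool \<Rightarrow> nat \<Rightarrow> 'a el) \<Rightarrow> 'a el" where
  "family n z = Family (map (\<lambda>i. (z False i, z True i)) [1..<Suc n])"

lemma is_family_family [simp]: "is_family n (family n z)"
  by (simp add: is_family_def family_def)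

lemma entry_family [simp]: "1 \<le> i \<Longrightarrow> i \<le> n \<Longrightarrow> entry (family n z) k i = z k i"
  by (cases i) (simp_all add: family_def del: upt_Suc)

lemma is_family_eqI:
  assumes "is_family n x" "is_family n y"
    "\<And>k i. 1 \<le> i \<Longrightarrow> i \<le> n \<Longrightarrow> entry x k i = entry y k i"
  shows "x = y"
proof -
  obtain xs ys where xs: "x = Family xs" "length xs = n" and ys: "y = Family ys" "length ys = n"
    using assms by (auto simp: is_family_def)
  have "xs = ys"
  proof (rule nth_equalityI)
    fix i
    assume "i < length xs"
    then show "xs ! i = ys ! i"
      using assms(3)[of "Suc i" True] assms(3)[of "Suc i" False] xs ys by (simp add: prod_eq_iff)
  qed (simp add: xs ys)
  then show ?thesis
    by (simp add: xs ys)
qed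

text \<open>
  \<open>boundary A R n z\<close> says that \<open>z\<close> is an empty \<open>n\<close>-cube of \<open>A\<close>, where empty squares have to be
  admissible with respect to the relation \<open>R\<close> on labels.
\<close>

definition boundary ::
  "('e, 'm) hda_scheme \<Rightarrow> ('e \<times> 'e) set \<Rightarrow> nat \<Rightarrow> (bool \<Rightarrow> nat \<Rightarrow> 'e) \<Rightarrow> bool" where
  "boundary A R n z \<longleftrightarrow>
     (\<forall>k i. 1 \<le> i \<and> i \<le> n \<longrightarrow> z k i \<in> Cubes A (n - 1)) \<and>
     (\<forall>k l i j. 1 \<le> i \<and> i < j \<and> j \<le> n \<longrightarrow>
        face A (n - 1) k i (z l j) = face A (n - 1) l (j - 1) (z k i)) \<and>
     (n = 2 \<longrightarrow> label A (z False 2) = label A (z True 2) \<and> label A (z False 1) = label A (z True 1) \<and>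
        (label A (z False 2), label A (z False 1)) \<in> R)"

text \<open>Characterises \<open>model T\<close> among the extensional HDAs with the 1-skeleton of
  \<open>T\<close>, for \<open>R\<close> the relation of \<open>T\<close>; see
  \<open>canon_iso\<close>. The relation constrains squares only, because the facets of an empty
  3-cube are squares of \<open>A\<close> and hence admissible already.\<close>

definition two_coskeletal :: "('e, 'm) hda_scheme \<Rightarrow> ('e \<times> 'e) set \<Rightarrow> bool" where
  "two_coskeletal A R \<longleftrightarrow>
     (\<forall>x \<in> Cubes A 2. (label A (face A 2 False 2 x), label A (face A 2 False 1 x)) \<in> R) \<and>
     (\<forall>n \<ge> 2. \<forall>x \<in> Cubes A n. \<forall>y \<in> Cubes A n.
        (\<forall>k i. 1 \<le> i \<and> i \<le> n \<longrightarrow> face A n k i x = face A n k i y) \<longrightarrow> x = y) \<and>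
     (\<forall>n \<ge> 2. \<forall>z. boundary A R n z \<longrightarrow>
        (\<exists>x \<in> Cubes A n. \<forall>k i. 1 \<le> i \<and> i \<le> n \<longrightarrow> face A n k i x = z k i))"

text \<open>Since opposite edges have equal labels, the admissibility of a square may be read off at
  any choice of \<open>k\<close> and \<open>l\<close>.\<close>

lemma boundaryD:
  assumes "boundary A R n z"
  shows "1 \<le> i \<Longrightarrow> i \<le> n \<Longrightarrow> z k i \<in> Cubes A (n - 1)"
    "\<lbrakk>1 \<le> i; i < j; j \<le> n\<rbrakk> \<Longrightarrow> face A (n - 1) k i (z l j) = face A (n - 1) l (j - 1) (z k i)"
    "n = 2 \<Longrightarrow> i = 1 \<or> i = 2 \<Longrightarrow> label A (z k i) = label A (z l i)"
    "n = 2 \<Longrightarrow> (label A (z k 2), label A (z l 1)) \<in> R"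
proof -
  show "label A (z k i) = label A (z l i)" if "n = 2" "i = 1 \<or> i = 2"
    using assms that unfolding boundary_def by (cases k; cases l) auto
  show "(label A (z k 2), label A (z l 1)) \<in> R" if "n = 2"
    using assms that unfolding boundary_def by (cases k; cases l) auto
qed (use assms in \<open>auto simp: boundary_def\<close>)

text \<open>Needed for \<open>entry (family n z)\<close>, which is known to agree with
  \<open>z\<close> only at indices from 1 to \<open>n\<close>.\<close>

lemma boundary_cong:
  assumes "boundary A R n z" "\<And>k i. 1 \<le> i \<Longrightarrow> i \<le> n \<Longrightarrow> z' k i = z k i"
  shows "boundary A R n z'"
  unfolding boundary_def
proof (intro conjI allI impI)
  note zD = boundaryD[OF assms(1)]
  fix k i
  assume "1 \<le> i \<and> i \<le> n"
  then show "z' k i \<in> Cubes A (n - 1)"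
    using zD(1) assms(2) by simp
next
  note zD = boundaryD[OF assms(1)]
  fix k l i j
  assume ij: "1 \<le> i \<and> i < j \<and> j \<le> n"
  then show "face A (n - 1) k i (z' l j) = face A (n - 1) l (j - 1) (z' k i)"
    using zD(2)[of i j k l] assms(2)[of i k] assms(2)[of j l] by simp
next
  note zD = boundaryD[OF assms(1)]
  assume n: "n = 2"
  show "label A (z' False 2) = label A (z' True 2)" "label A (z' False 1) = label A (z' True 1)"
    "(label A (z' False 2), label A (z' False 1)) \<in> R"
    using zD(3)[OF n, of 2 False True] zD(3)[OF n, of 1 False True] zD(4)[OF n, of False False]
      assms(2) n by simp_all
qed

lemma two_coskeletalD:
  assumes "two_coskeletal A R"
  shows "x \<in> Cubes A 2 \<Longrightarrow> (label A (face A 2 False 2 x), label A (face A 2 False 1 x)) \<in> R"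
    "\<lbrakk>2 \<le> n; x \<in> Cubes A n; y \<in> Cubes A n;
      \<And>k i. 1 \<le> i \<Longrightarrow> i \<le> n \<Longrightarrow> face A n k i x = face A n k i y\<rbrakk> \<Longrightarrow> x = y"
    "\<lbrakk>2 \<le> n; boundary A R n z\<rbrakk> \<Longrightarrow>
      \<exists>x \<in> Cubes A n. \<forall>k i. 1 \<le> i \<longrightarrow> i \<le> n \<longrightarrow> face A n k i x = z k i"
  using assms unfolding two_coskeletal_def by blast+

section \<open>The model of a transition system\<close>

definition model :: "'a el lts \<Rightarrow> 'a el hda" where
  "model T = Gamma2_obj (Psi_obj T)"

lemma model_simps [simp]:
  "Init (model T) = Init T" "Final (model T) = Final T"
  "Labels (model T) = Labels T" "label (model T) = label T"
  by (simp_all add: model_def Gamma2_obj_def Psi_obj_def hda.defs)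

lemma Cubes_model_low: "n \<le> 1 \<Longrightarrow> Cubes (model T) n = Cubes T n"
  by (cases n) (auto simp: model_def Gamma2_obj_def Psi_obj_def)

lemma face_model:
  "face (model T) n k i x = (if n \<le> 1 then face T n k i x else entry x k i)"
  by (auto simp: model_def Gamma2_obj_def Psi_obj_def cosk_face_def)

lemma mem_empty_cubes_iff:
  "x \<in> empty_cubes X d n \<longleftrightarrow> is_family n x \<and> (\<forall>k i. 1 \<le> i \<and> i \<le> n \<longrightarrow> entry x k i \<in> X) \<and>
     (\<forall>k l i j. 1 \<le> i \<and> i < j \<and> j \<le> n \<longrightarrow> d k i (entry x l j) = d l (j - 1) (entry x k i))"
proof -
  have "set xs \<subseteq> X \<times> X \<longleftrightarrow> (\<forall>k i. 1 \<le> i \<and> i \<le> length xs \<longrightarrow> entry (Family xs) k i \<in> X)" for xs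
  proof
    assume *: "\<forall>k i. 1 \<le> i \<and> i \<le> length xs \<longrightarrow> entry (Family xs) k i \<in> X"
    have "xs ! i \<in> X \<times> X" if "i < length xs" for i
      using *[rule_format, of "Suc i" True] *[rule_format, of "Suc i" False] that
      by (simp add: mem_Times_iff)
    then show "set xs \<subseteq> X \<times> X"
      by (metis in_set_conv_nth subsetI)
  next
    assume *: "set xs \<subseteq> X \<times> X"
    have "xs ! (i - 1) \<in> X \<times> X" if "1 \<le> i" "i \<le> length xs" for i
      using * nth_mem[of "i - 1" xs] that by auto
    then show "\<forall>k i. 1 \<le> i \<and> i \<le> length xs \<longrightarrow> entry (Family xs) k i \<in> X"
      by (auto simp: mem_Times_iff)
  qed
  then show ?thesis
    unfolding empty_cubes_def is_family_def by blast
qed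

text \<open>Independence squares and the cubes added by the coskeleton obey one description: for
  \<open>n = 2\<close> the label condition in \<open>boundary\<close> is the independence condition,
  and for larger \<open>n\<close> it is vacuous.\<close>

lemma Cubes_model:
  assumes "2 \<le> n"
  shows "x \<in> Cubes (model T) n \<longleftrightarrow> is_family n x \<and> boundary (model T) (ltimes T) n (entry x)"
proof (cases "n = 2")
  case True
  then have "Cubes (model T) n = independence_squares T"
    by (simp add: model_def Gamma2_obj_def Psi_obj_def numeral_2_eq_2)
  then show ?thesis
    using True by (simp add: independence_squares_def mem_empty_cubes_iff boundary_def
        face_model Cubes_model_low)
next
  case False
  then obtain m where m: "n = Suc m" "2 \<le> m"
    using assms by (cases n) auto
  then have "Cubes (model T) n = empty_cubes (Cubes (model T) m) (face (model T) m) n"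
    by (simp add: model_def Gamma2_obj_def)
  then show ?thesis
    using m by (simp add: mem_empty_cubes_iff boundary_def)
qed

text \<open>In degrees at least 2 the face maps are \<open>entry\<close>, so the precubical
  identities are the compatibility conditions of \<open>boundary\<close>.\<close>

lemma is_hda_model:
  assumes "is_lts T"
  shows "is_hda (model T)"
proof -
  have T: "is_hda T"
    using assms by (simp add: is_lts_def is_transition_system_def)
  note hT = is_hdaD[OF T]
  show ?thesis
    unfolding is_hda_def
  proof (intro conjI allI ballI impI)
    fix n :: nat and k i
    assume i: "1 \<le> i \<and> i \<le> n"
    show "face (model T) n k i \<in> Cubes (model T) n \<rightarrow> Cubes (model T) (n - 1)"
    proof (cases "n \<le> 1")
      case True
      then show ?thesis
        using hT(1)[of _ n i] i by (auto simp: face_model Cubes_model_low)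
    next
      case False
      then show ?thesis
        using boundaryD(1)[of "model T" "ltimes T" n] i by (auto simp: face_model Cubes_model)
    qed
  next
    fix n k l i j x
    assume x: "x \<in> Cubes (model T) n" and ij: "1 \<le> i \<and> i < j \<and> j \<le> n"
    then have "boundary (model T) (ltimes T) n (entry x)"
      by (simp add: Cubes_model)
    from boundaryD(2)[OF this, of i j k l]
    show "face (model T) (n - 1) k i (face (model T) n l j x) =
        face (model T) (n - 1) l (j - 1) (face (model T) n k i x)"
      using ij by (simp add: face_model[of T n])
  next
    fix x i
    assume "x \<in> Cubes (model T) 2" "i \<in> {1, 2 :: nat}"
    then show "label (model T) (face (model T) 2 False i x) = label (model T) (face (model T) 2 True i x)"
      by (auto simp: Cubes_model boundary_def face_model)
  qed (use hT in \<open>auto simp: Cubes_model_low\<close>)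
qed

lemma model_ok:
  assumes "is_lts T"
  shows "HDA.ok (model T)"
  using assms is_hda_model[OF assms]
  by (auto simp: ok_HDA is_lts_def is_transition_system_def is_extensional_def
      Cubes_model_low face_model)

lemma two_coskeletal_model: "two_coskeletal (model T) (ltimes T)"
  unfolding two_coskeletal_def
proof (intro conjI allI ballI impI)
  fix x
  assume "x \<in> Cubes (model T) 2"
  then show "(label (model T) (face (model T) 2 False 2 x), label (model T) (face (model T) 2 False 1 x))
      \<in> ltimes T"
    using boundaryD(4)[of "model T" "ltimes T" 2 "entry x" False False]
    by (simp add: Cubes_model face_model)
next
  fix n :: nat and x y
  assume n: "2 \<le> n" and xy: "x \<in> Cubes (model T) n" "y \<in> Cubes (model T) n"
    and eq: "\<forall>k i. 1 \<le> i \<and> i \<le> n \<longrightarrow> face (model T) n k i x = face (model T) n k i y"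
  have "is_family n x" "is_family n y"
    using xy n by (simp_all only: Cubes_model)
  then show "x = y"
    by (rule is_family_eqI) (use eq n in \<open>simp add: face_model\<close>)
next
  fix n :: nat and z
  assume n: "2 \<le> n" and z: "boundary (model T) (ltimes T) n z"
  from z have "boundary (model T) (ltimes T) n (entry (family n z))"
    by (rule boundary_cong) simp
  then have "family n z \<in> Cubes (model T) n"
    using n by (simp add: Cubes_model)
  then show "\<exists>x \<in> Cubes (model T) n. \<forall>k i. 1 \<le> i \<and> i \<le> n \<longrightarrow> face (model T) n k i x = z k i"
    using n by (intro bexI[of _ "family n z"]) (auto simp: face_model)
qed

text \<open>Induction on the degree: by the induction hypothesis the two images of a cube have the
  same faces, and fillers in the model are unique.\<close>

lemma mor_to_model_eqI:
  assumes f: "is_hda_mor f" and g: "is_hda_mor g" and src: "src f = X" "src g = X"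
    and tgt: "tgt f = model T" "tgt g = model T" and X: "is_hda X"
    and low: "\<And>n x. n \<le> 1 \<Longrightarrow> x \<in> Cubes X n \<Longrightarrow> on_cubes f n x = on_cubes g n x"
    and lab: "\<And>a. a \<in> Labels X \<Longrightarrow> on_labels f a = on_labels g a"
  shows "f = g"
proof (rule mor_eqI[OF f g])
  fix n x
  assume "x \<in> Cubes (src f) n"
  then show "on_cubes f n x = on_cubes g n x"
  proof (induction n arbitrary: x)
    case 0
    then show ?case
      using low src by simp
  next
    case (Suc m)
    then have x: "x \<in> Cubes X (Suc m)"
      by (simp add: src)
    show ?case
    proof (cases "m = 0")
      case True
      then show ?thesis
        using low x by simp
    next
      case False
      then have m: "2 \<le> Suc m" by simp
      show ?thesis
      proof (rule two_coskeletalD(2)[OF two_coskeletal_model m])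
        show "on_cubes f (Suc m) x \<in> Cubes (model T) (Suc m)" "on_cubes g (Suc m) x \<in> Cubes (model T) (Suc m)"
          using mor_cube[OF f] mor_cube[OF g] x src tgt by auto
        fix k i
        assume i: "1 \<le> i" "i \<le> Suc m"
        then show "face (model T) (Suc m) k i (on_cubes f (Suc m) x) =
            face (model T) (Suc m) k i (on_cubes g (Suc m) x)"
          using mor_face[OF f, of x "Suc m" i k] mor_face[OF g, of x "Suc m" i k] x src tgt
            Suc.IH[of "face X (Suc m) k i x"] hda_face[OF X x i] by simp
      qed
    qed
  qed
qed (use assms in auto)

text \<open>By \<open>fam\<close> and \<open>ent\<close>, a higher cube goes to the family of the
  images of its faces, and this family is a boundary by the precubical identities of
  \<open>X\<close>; the squares moreover need \<open>sq\<close>. The lemma serves both the action of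
  the functor on morphisms and the canonical maps into models.\<close>

lemma mor_to_model:
  assumes X: "is_hda X"
    and f0: "\<And>x. x \<in> Cubes X 0 \<Longrightarrow> f 0 x \<in> Cubes T 0"
    and f1: "\<And>x. x \<in> Cubes X 1 \<Longrightarrow> f 1 x \<in> Cubes T 1"
    and d1: "\<And>k x. x \<in> Cubes X 1 \<Longrightarrow> f 0 (face X 1 k 1 x) = face T 1 k 1 (f 1 x)"
    and init: "f 0 (Init X) = Init T"
    and fin: "\<And>x. x \<in> Final X \<Longrightarrow> f 0 x \<in> Final T"
    and s: "\<And>a. a \<in> Labels X \<Longrightarrow> s a \<in> Labels T"
    and lab: "\<And>x. x \<in> Cubes X 1 \<Longrightarrow> label T (f 1 x) = s (label X x)"
    and sq: "\<And>x. x \<in> Cubes X 2 \<Longrightarrow>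
      (s (label X (face X 2 False 2 x)), s (label X (face X 2 False 1 x))) \<in> ltimes T"
    and fam: "\<And>n x. 2 \<le> n \<Longrightarrow> x \<in> Cubes X n \<Longrightarrow> is_family n (f n x)"
    and ent: "\<And>n k i x. \<lbrakk>2 \<le> n; x \<in> Cubes X n; 1 \<le> i; i \<le> n\<rbrakk> \<Longrightarrow>
      entry (f n x) k i = f (n - 1) (face X n k i x)"
  shows "is_hda_mor (mk_mor X (model T) f s)"
proof -
  note hX = is_hdaD[OF X]
  have d: "f (n - 1) (face X n k i x) = face (model T) n k i (f n x)"
    if "x \<in> Cubes X n" "1 \<le> i" "i \<le> n" for n k i x
  proof (cases "n \<le> 1")
    case True
    then have "n = 1" "i = 1"
      using that by auto
    then show ?thesis
      using d1 that by (simp add: face_model)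
  next
    case False
    then show ?thesis
      using ent[of n x i k] that by (simp add: face_model)
  qed
  have cubes: "f n x \<in> Cubes (model T) n" if "x \<in> Cubes X n" for n x
    using that
  proof (induction n arbitrary: x)
    case 0
    then show ?case
      using f0 by (simp add: Cubes_model_low)
  next
    case (Suc m)
    show ?case
    proof (cases "m = 0")
      case True
      then show ?thesis
        using f1 Suc.prems by (simp add: Cubes_model_low)
    next
      case False
      then have m: "2 \<le> Suc m" by simp
      note e = ent[OF m Suc.prems, simplified]
      have "boundary (model T) (ltimes T) (Suc m) (entry (f (Suc m) x))"
        unfolding boundary_def
      proof (intro conjI allI impI)
        fix k i
        assume i: "1 \<le> i \<and> i \<le> Suc m"
        then show "entry (f (Suc m) x) k i \<in> Cubes (model T) (Suc m - 1)"
          using Suc.IH[of "face X (Suc m) k i x"] hX(1)[OF Suc.prems, of i k] e[of i k] by simp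
      next
        fix k l i j
        assume ij: "1 \<le> i \<and> i < j \<and> j \<le> Suc m"
        then have j1: "Suc 0 \<le> j - Suc 0" "j - Suc 0 \<le> m"
          by auto
        \<comment> \<open>The precubical identity of \<open>X\<close>, transported by
          \<open>d\<close> applied to the two facets.\<close>
        from ij show "face (model T) (Suc m - 1) k i (entry (f (Suc m) x) l j) =
            face (model T) (Suc m - 1) l (j - 1) (entry (f (Suc m) x) k i)"
          using hX(1)[OF Suc.prems, of i k] hX(1)[OF Suc.prems, of j l] e[of i k] e[of j l]
            d[of "face X (Suc m) l j x" m i k] d[of "face X (Suc m) k i x" m "j - 1" l]
            hX(2)[OF Suc.prems, of i j k l] j1 by simp
      next
        assume "Suc m = 2"
        then have m1: "m = 1" by simp
        then have x: "x \<in> Cubes X 2"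
          using Suc.prems by (simp add: numeral_2_eq_2)
        have l: "label (model T) (entry (f (Suc m) x) k i) = s (label X (face X 2 k i x))"
          if "i = 1 \<or> i = 2" for k i
          using e[of i k] lab[of "face X 2 k i x"] hX(1)[OF x, of i k] that m1
          by (auto simp: numeral_2_eq_2)
        show "label (model T) (entry (f (Suc m) x) False 2) = label (model T) (entry (f (Suc m) x) True 2)"
          "label (model T) (entry (f (Suc m) x) False 1) = label (model T) (entry (f (Suc m) x) True 1)"
          "(label (model T) (entry (f (Suc m) x) False 2), label (model T) (entry (f (Suc m) x) False 1))
            \<in> ltimes T"
          using l hX(6)[OF x, of 2 False True] hX(6)[OF x, of 1 False True] sq[OF x] by simp_all
      qed
      then show ?thesis
        using fam[OF m Suc.prems] by (simp only: Cubes_model[OF m])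
    qed
  qed
  show ?thesis
    by (rule is_hda_mor_mk_mor[OF X cubes]) (use d init fin s lab in auto)
qed

section \<open>Tensor products of 2-coskeletal automata\<close>

text \<open>
  \<open>face_deg i p\<close> is the left degree of the \<open>i\<close>-th face of a cube of left degree \<open>p\<close> in a tensor product.
\<close>

definition face_deg :: "nat \<Rightarrow> nat \<Rightarrow> nat" where
  "face_deg i p = (if i \<le> p then p - 1 else p)"

text \<open>\<open>p k i\<close> is the left degree of a facet, and \<open>comp\<close> is what the
  face identities say about degrees. For \<open>n = 2\<close> the conclusion can fail: there
  \<open>comp\<close> only compares predecessors of numbers at most 1, all of which are 0.\<close>

lemma face_deg_family:
  fixes p :: "bool \<Rightarrow> nat \<Rightarrow> nat"
  assumes n: "3 \<le> n"
    and bound: "\<And>k i. 1 \<le> i \<Longrightarrow> i \<le> n \<Longrightarrow> p k i \<le> n - 1"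
    and comp: "\<And>k l i j. \<lbrakk>1 \<le> i; i < j; j \<le> n\<rbrakk> \<Longrightarrow> face_deg i (p l j) = face_deg (j - 1) (p k i)"
  shows "\<exists>P \<le> n. \<forall>k i. 1 \<le> i \<longrightarrow> i \<le> n \<longrightarrow> p k i = face_deg i P"
proof (intro exI conjI allI impI)
  \<comment> \<open>For \<open>P < n\<close> the last facet has left degree \<open>P\<close>. If
    that degree is \<open>n - 1\<close>, both \<open>P = n - 1\<close> and \<open>P = n\<close> are
    possible, and the first facet, of left degree \<open>P - 1\<close>, decides.\<close>
  let ?P = "if p False n < n - 1 then p False n else Suc (p False 1)"
  show "?P \<le> n"
    using bound[of n False] bound[of 1 False] n by auto
  fix k i
  assume i: "1 \<le> i" "i \<le> n"
  \<comment> \<open>On degrees up to \<open>n - 1\<close>, \<open>face_deg 1\<close> identifies 0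
    with 1, and \<open>face_deg (n - 1)\<close> identifies \<open>n - 2\<close> with
    \<open>n - 1\<close>. Comparisons with the first and the last facet therefore lose information
    at the ends of the range, and the cases below recover it.\<close>
  have first: "face_deg 1 q = q - 1" for q
    by (simp add: face_deg_def)
  have last: "face_deg (n - 1) (p k i) = min (p k i) (n - 2)" if "1 \<le> i" "i \<le> n" for k i
    using bound[OF that, of k] by (auto simp: face_deg_def)
  have c1n: "p l n - 1 = min (p k 1) (n - 2)" for k l
    using comp[of 1 n l k] n last[of 1 k] first by simp
  have c12: "p l 2 - 1 = p k 1 - 1" for k l
    using comp[of 1 2 l k] n first by simp
  have c2n: "face_deg 2 (p l n) = min (p k 2) (n - 2)" for k l
    using comp[of 2 n l k] n last[of 2 k] by simp
  consider "i = 1" | "i = n" | "1 < i" "i < n"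
    using i by linarith
  note cases = this
  have mid: "p k i - 1 = face_deg (i - 1) (p False 1)" "face_deg i (p False n) = min (p k i) (n - 2)"
    if "1 < i" "i < n"
    using comp[of 1 i k False] comp[of i n False k] that first last[of i k] by auto
  show "p k i = face_deg i ?P"
  proof (cases "p False n < n - 1")
    case True
    have P1: "p False 1 = p False n - 1"
      using c1n[of False False] True n by (auto simp: min_def split: if_splits)
    from cases show ?thesis
    proof cases
      case 1
      then show ?thesis
        using c1n[of False k] True n by (auto simp: first[simplified] min_def split: if_splits)
    next
      case 2
      \<comment> \<open>Equal predecessors leave open only 0 against 1, and
        \<open>face_deg 2\<close> separates these two.\<close>
      have "p k n - 1 = p False n - 1" "face_deg 2 (p k n) = face_deg 2 (p False n)"
        using c1n[of k False] c1n[of False False] c2n[of k False] c2n[of False False] by auto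
      then have "p k n = p False n"
        by (auto simp: face_deg_def split: if_splits)
      then show ?thesis
        using 2 True by (auto simp: face_deg_def)
    next
      case 3
      \<comment> \<open>The minimum in \<open>mid\<close> does not tell \<open>n - 2\<close> from
        \<open>n - 1\<close>; the comparison with the first facet excludes
        \<open>n - 1\<close>.\<close>
      have "p k i \<le> n - 2"
      proof (rule ccontr)
        assume "\<not> p k i \<le> n - 2"
        then have *: "face_deg i (p False n) = n - 2" "n - 2 \<le> p k i - 1"
          using mid[OF 3] by auto
        then have "p False n = n - 2" "i = n - 1"
          using True 3 by (auto simp: face_deg_def split: if_splits)
        then have "face_deg (i - 1) (p False 1) = n - 3"
          using P1 n by (simp add: face_deg_def)
        then show False
          using mid[OF 3] * n by simp
      qed
      then show ?thesis
        using mid[OF 3] True by simp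
    qed
  next
    case False
    then have pn: "p False n = n - 1"
      using bound[of n False] n by simp
    then have p1: "n - 2 \<le> p False 1" "p False 1 \<le> n - 1"
      using c1n[of False False] bound[of 1 False] n by (auto simp: min_def split: if_splits)
    from cases show ?thesis
    proof cases
      case 1
      have "p k 1 - 1 = p False 1 - 1" "n - 2 \<le> p k 1"
        using c12[of False k] c12[of False False] c1n[of False k] pn
        by (auto simp: min_def split: if_splits)
      then show ?thesis
        using 1 False p1 n by (auto simp: face_deg_def)
    next
      case 2
      have "p k n - 1 = n - 2"
        using c1n[of k False] p1 by simp
      then show ?thesis
        using 2 False p1 n by (auto simp: face_deg_def)
    next
      case 3
      have "n - 2 \<le> p k i" "p k i - 1 = p False 1 - 1"
        using mid[OF 3] 3 pn p1
        by (auto simp: face_deg_def min_def numeral_2_eq_2 split: if_splits)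
      then show ?thesis
        using 3 False p1 n by (auto simp: face_deg_def)
    qed
  qed
qed

text \<open>If \<open>p < q\<close>, direction \<open>q\<close> forces \<open>q = p + 1\<close>;
  then direction 1 tells \<open>p\<close> and \<open>q\<close> apart, or direction 2 if
  \<open>p = 0\<close>. For \<open>n = 1\<close> this breaks down: edges of left degree 0 and 1 both
  have faces of left degree 0.\<close>

lemma face_deg_inj:
  assumes "2 \<le> n" "p \<le> n" "q \<le> n" and eq: "\<And>i. 1 \<le> i \<Longrightarrow> i \<le> n \<Longrightarrow> face_deg i p = face_deg i q"
  shows "p = q"
proof -
  have False if pq: "p < q" "q \<le> n" and eq: "\<And>i. 1 \<le> i \<Longrightarrow> i \<le> n \<Longrightarrow> face_deg i p = face_deg i q" for p q
  proof -
    have q: "q = p + 1"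
      using eq[of q] pq by (simp add: face_deg_def)
    show False
    proof (cases "p = 0")
      case True
      then show False
        using eq[of 2] assms(1) q by (simp add: face_deg_def)
    next
      case False
      then show False
        using eq[of 1] assms(1) q by (simp add: face_deg_def)
    qed
  qed
  then show ?thesis
    using assms by (metis linorder_neqE_nat)
qed

text \<open>The alphabets and relations of an interleaving are parameters here, so that the filling
  theorem can be stated for arbitrary HDAs.\<close>

definition tensor_rel where
  "tensor_rel L R M Q =
    {(Left a, Left b) | a b. (a, b) \<in> R} \<union> {(Right a, Right b) | a b. (a, b) \<in> Q} \<union>
    {(Left a, Right b) | a b. a \<in> L \<and> b \<in> M}"

lemma tensor_rel_iff [simp]:
  "(Left a, Left a') \<in> tensor_rel L R M Q \<longleftrightarrow> (a, a') \<in> R"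
  "(Right b, Right b') \<in> tensor_rel L R M Q \<longleftrightarrow> (b, b') \<in> Q"
  "(Left a, Right b) \<in> tensor_rel L R M Q \<longleftrightarrow> a \<in> L \<and> b \<in> M"
  "(Right b, Left a) \<notin> tensor_rel L R M Q"
  by (auto simp: tensor_rel_def)

lemma ltimes_interleave:
  "ltimes (interleave S T) = tensor_rel (Labels S) (ltimes S) (Labels T) (ltimes T)"
  by (auto simp: TS.rel_tens tensor_rel_def)

section \<open>Fillers in a tensor product\<close>

lemma Cubes_tensorE:
  fixes A B :: "'a el hda"
  assumes "x \<in> Cubes (tensor A B) n"
  obtains p a b where "p \<le> n" "x = Pair p a (n - p) b" "a \<in> Cubes A p" "b \<in> Cubes B (n - p)"
  using assms by (auto simp: HDA.Cubes_tens)

text \<open>From dimension 3 on \<open>P\<close> comes from \<open>face_deg_family\<close>, applied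
  to the left degrees in the face identities; in dimension 2 the labels take over this task.\<close>

lemma boundary_tensor_degrees:
  fixes A B :: "'a el hda"
  assumes n: "2 \<le> n" and z: "boundary (tensor A B) (tensor_rel (Labels A) R (Labels B) Q) n z"
  obtains P u v where "P \<le> n"
    "\<And>k i. 1 \<le> i \<Longrightarrow> i \<le> n \<Longrightarrow>
       z k i = Pair (face_deg i P) (u k i) (n - 1 - face_deg i P) (v k i) \<and>
       u k i \<in> Cubes A (face_deg i P) \<and> v k i \<in> Cubes B (n - 1 - face_deg i P)"
proof -
  note zD = boundaryD[OF z]
  have "\<exists>p a b. p \<le> n - 1 \<and> z k i = Pair p a (n - 1 - p) b \<and> a \<in> Cubes A p \<and> b \<in> Cubes B (n - 1 - p)"
    if "1 \<le> i" "i \<le> n" for k i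
    using zD(1)[OF that, of k] by (meson Cubes_tensorE)
  then have "\<forall>k i. \<exists>p a b. 1 \<le> i \<and> i \<le> n \<longrightarrow>
      p \<le> n - 1 \<and> z k i = Pair p a (n - 1 - p) b \<and> a \<in> Cubes A p \<and> b \<in> Cubes B (n - 1 - p)"
    by blast
  then obtain p u v where puv: "\<And>k i. 1 \<le> i \<Longrightarrow> i \<le> n \<Longrightarrow> p k i \<le> n - 1 \<and>
      z k i = Pair (p k i) (u k i) (n - 1 - p k i) (v k i) \<and>
      u k i \<in> Cubes A (p k i) \<and> v k i \<in> Cubes B (n - 1 - p k i)"
    by metis
  have "\<exists>P \<le> n. \<forall>k i. 1 \<le> i \<longrightarrow> i \<le> n \<longrightarrow> p k i = face_deg i P"
  proof (cases "n = 2")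
    case False
    show ?thesis
    proof (rule face_deg_family)
      show "3 \<le> n"
        using n False by simp
      show "p k i \<le> n - 1" if "1 \<le> i" "i \<le> n" for k i
        using puv that by blast
      show "face_deg i (p l j) = face_deg (j - 1) (p k i)" if ij: "1 \<le> i" "i < j" "j \<le> n" for k l i j
        using zD(2)[OF ij, of k l] puv[of j l] puv[of i k] ij
        by (auto simp: HDA.face_tens face_deg_def split: if_splits)
    qed
  next
    case True
    have lab: "label (tensor A B) (z k i) =
        (if p k i = 1 then Left (label A (u k i)) else Right (label B (v k i)))"
      if "i = 1 \<or> i = 2" for k i
      using puv[of i k] that True by (auto simp: HDA.label_tens)
    \<comment> \<open>Opposite edges of the square have equal labels and hence lie in the same
      summand.\<close>
    have eq: "p k i = p l i" if "i = 1 \<or> i = 2" for k l i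
      using zD(3)[OF True that, of k l] lab[OF that] puv[of i k] puv[of i l] that True
      by (auto split: if_splits)
    \<comment> \<open>This would be a square with its directions exchanged: its labels would be a
      \<open>Right\<close> before a \<open>Left\<close>, and \<open>tensor_rel\<close> contains no
      such pair.\<close>
    have "\<not> (p False 2 = 0 \<and> p False 1 = 1)"
      using zD(4)[OF True, of False False] lab[of 2 False] lab[of 1 False] by auto
    moreover have "p False 2 \<le> 1" "p False 1 \<le> 1"
      using puv[of 2 False] puv[of 1 False] True by auto
    \<comment> \<open>The remaining left degrees in directions 1 and 2 are 0, 0 or 0, 1 or 1, 1.
      They belong to squares with \<open>P\<close> equal to 0, 1 and 2, which is their sum.\<close>
    ultimately have "p k i = face_deg i (p False 1 + p False 2)" if "i = 1 \<or> i = 2" for k i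
      using eq[OF that, of k False] that by (auto simp: face_deg_def)
    moreover have "p False 1 + p False 2 \<le> n"
      using puv[of 2 False] puv[of 1 False] True by auto
    moreover have "i = 1 \<or> i = 2" if "1 \<le> i" "i \<le> n" for i
      using that True by linarith
    ultimately show ?thesis
      by blast
  qed
  then show thesis
    using puv that by metis
qed

lemma two_coskeletal_tensor:
  fixes A B :: "'a el hda"
  assumes A: "is_hda A" "is_extensional A" "two_coskeletal A R"
    and B: "is_hda B" "is_extensional B" "two_coskeletal B Q"
  shows "two_coskeletal (tensor A B) (tensor_rel (Labels A) R (Labels B) Q)"
    (is "two_coskeletal ?AB ?RQ")
  unfolding two_coskeletal_def
proof (intro conjI allI ballI impI)
  note hA = is_hdaD[OF A(1)] and hB = is_hdaD[OF B(1)]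
  fix x
  assume "x \<in> Cubes ?AB 2"
  then obtain p a b where x: "p \<le> 2" "x = Pair p a (2 - p) b" "a \<in> Cubes A p" "b \<in> Cubes B (2 - p)"
    by (rule Cubes_tensorE)
  then consider "p = 0" | "p = 1" | "p = 2"
    by linarith
  then show "(label ?AB (face ?AB 2 False 2 x), label ?AB (face ?AB 2 False 1 x)) \<in> ?RQ"
  proof cases
    case 1
    then show ?thesis
      using x two_coskeletalD(1)[OF B(3), of b] by (simp add: HDA.face_tens HDA.label_tens)
  next
    \<comment> \<open>The facet in direction 2 is an edge of the left factor and that in direction 1
      an edge of the right factor, which is the order of the mixed pairs of
      \<open>tensor_rel\<close>.\<close>
    case 2
    then show ?thesis
      using x hA(5) hB(5) by (simp add: HDA.face_tens HDA.label_tens)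
  next
    case 3
    then show ?thesis
      using x two_coskeletalD(1)[OF A(3), of a] by (simp add: HDA.face_tens HDA.label_tens)
  qed
next
  fix n :: nat and x y
  assume n: "2 \<le> n" and xy: "x \<in> Cubes ?AB n" "y \<in> Cubes ?AB n"
    and eq: "\<forall>k i. 1 \<le> i \<and> i \<le> n \<longrightarrow> face ?AB n k i x = face ?AB n k i y"
  obtain p a b where x: "p \<le> n" "x = Pair p a (n - p) b" "a \<in> Cubes A p" "b \<in> Cubes B (n - p)"
    using xy(1) by (rule Cubes_tensorE)
  obtain p' a' b' where y: "p' \<le> n" "y = Pair p' a' (n - p') b'" "a' \<in> Cubes A p'" "b' \<in> Cubes B (n - p')"
    using xy(2) by (rule Cubes_tensorE)
  have "face_deg i p = face_deg i p'" if "1 \<le> i" "i \<le> n" for i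
    using eq[rule_format, of i] that x(2) y(2)
    by (auto simp: HDA.face_tens face_deg_def split: if_splits)
  then have p: "p' = p"
    using face_deg_inj n x(1) y(1) by metis
  have left: "face A p k i a = face A p k i a' \<and> b = b'" if "1 \<le> i" "i \<le> p" for k i
    using eq[rule_format, of i k] that x y p by (simp add: HDA.face_tens)
  have right: "face B (n - p) k i b = face B (n - p) k i b' \<and> a = a'" if "1 \<le> i" "i \<le> n - p" for k i
    using eq[rule_format, of "p + i" k] that x y p by (simp add: HDA.face_tens)
  \<comment> \<open>A face in a direction of the right factor contains \<open>a\<close> unchanged.
    Such a direction exists unless \<open>p = n\<close>, and then uniqueness of fillers in
    \<open>A\<close> applies. The argument for \<open>b\<close> is symmetric.\<close>
  have "a = a'"
  proof (cases "p = n")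
    case True
    then show ?thesis
      using two_coskeletalD(2)[OF A(3) n, of a a'] left x y p by simp
  qed (use right[of 1] x(1) in simp)
  moreover have "b = b'"
  proof (cases "p = 0")
    case True
    then show ?thesis
      using two_coskeletalD(2)[OF B(3) n, of b b'] right x y p by simp
  qed (use left[of 1] in simp)
  ultimately show "x = y"
    by (simp add: x y p)
next
  fix n :: nat and z
  assume n: "2 \<le> n" and z: "boundary ?AB ?RQ n z"
  note zD = boundaryD[OF z]
  obtain P u v where P: "P \<le> n" and uv: "\<And>k i. 1 \<le> i \<Longrightarrow> i \<le> n \<Longrightarrow>
       z k i = Pair (face_deg i P) (u k i) (n - 1 - face_deg i P) (v k i) \<and>
       u k i \<in> Cubes A (face_deg i P) \<and> v k i \<in> Cubes B (n - 1 - face_deg i P)"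
    using boundary_tensor_degrees[OF n z] by blast
  define m where "m = n - P"
  have z_left: "z k i = Pair (P - 1) (u k i) m (v k i)" "u k i \<in> Cubes A (P - 1)" "v k i \<in> Cubes B m"
    if "1 \<le> i" "i \<le> P" for k i
    using uv[of i k] that P by (auto simp: face_deg_def m_def)
  have z_right: "z k (P + i) = Pair P (u k (P + i)) (m - 1) (v k (P + i))"
    "u k (P + i) \<in> Cubes A P" "v k (P + i) \<in> Cubes B (m - 1)"
    if "1 \<le> i" "i \<le> m" for k i
    using uv[of "P + i" k] that P by (auto simp: face_deg_def m_def)
  \<comment> \<open>\<open>LL\<close>, \<open>RR\<close> and \<open>LR\<close> split a face identity
    into its two components; the letters tell to which factors the two directions belong. In
    \<open>LL\<close> and \<open>RR\<close> the component in the other factor is untouched, which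
    yields equal members of \<open>v\<close> and of \<open>u\<close>.\<close>
  have LL: "v l j = v k i \<and> face A (P - 1) k i (u l j) = face A (P - 1) l (j - 1) (u k i)"
    if "1 \<le> i" "i < j" "j \<le> P" for k l i j
  proof -
    have "i \<le> P - 1" "j - 1 \<le> P - 1" "j \<le> n"
      using that P by auto
    then show ?thesis
      using zD(2)[of i j k l] z_left[of i k] z_left[of j l] that by (simp add: HDA.face_tens)
  qed
  have RR: "u l (P + j) = u k (P + i) \<and>
      face B (m - 1) k i (v l (P + j)) = face B (m - 1) l (j - 1) (v k (P + i))"
    if "1 \<le> i" "i < j" "j \<le> m" for k l i j
  proof -
    have "P + j \<le> n" "P + j - 1 - P = j - 1" "\<not> P + j - 1 \<le> P"
      using that P by (auto simp: m_def)
    then show ?thesis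
      using zD(2)[of "P + i" "P + j" k l] z_right[of i k] z_right[of j l] that
      by (simp add: HDA.face_tens)
  qed
  have LR: "face A P k i (u l (P + j)) = u k i \<and> v l (P + j) = face B m l j (v k i)"
    if "1 \<le> i" "i \<le> P" "1 \<le> j" "j \<le> m" for k l i j
  proof -
    have "P + j \<le> n" "i < P + j" "\<not> P + j - 1 \<le> P - 1" "P + j - 1 - (P - 1) = j"
      using that P by (auto simp: m_def)
    then show ?thesis
      using zD(2)[of i "P + j" k l] z_left[of i k] z_right[of j l] that by (simp add: HDA.face_tens)
  qed
  \<comment> \<open>For \<open>P > 1\<close>, \<open>LL\<close> compares different directions, and
    opposite facets by way of another direction. For \<open>P = 1\<close> only one opposite pair is
    left; by \<open>LR\<close> its second components have the same faces, so uniqueness of fillers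
    applies, or extensionality if they are edges.\<close>
  have v_const: "v k i = v False 1" if i: "1 \<le> i" "i \<le> P" for k i
  proof (cases "P = 1")
    case False
    then have "v l 2 = v k 1" for k l
      using LL[of 1 2] i by simp
    moreover have "v k i = v False 1" if "1 < i"
      using LL[of 1 i] i that by simp
    ultimately show ?thesis
      using i by (metis le_neq_implies_less)
  next
    case True
    then have i1: "i = 1" and m: "m = n - 1"
      using i by (auto simp: m_def)
    have faces: "face B m l j (v k 1) = face B m l j (v False 1)" if "1 \<le> j" "j \<le> m" for l j
      using LR[of 1 j k l] LR[of 1 j False l] that True by simp
    show ?thesis
    proof (cases "n = 2")
      case False
      then have "2 \<le> m"
        using m n by simp
      then show ?thesis
        using two_coskeletalD(2)[OF B(3), of m "v k 1" "v False 1"] faces z_left[of 1] True i1 by simp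
    next
      case n2: True
      then have "label B (v k 1) = label B (v False 1)"
        using zD(3)[OF n2, of 1 k False] z_left(1)[of 1] True by (simp add: HDA.label_tens)
      then show ?thesis
        using extensionalD[OF B(2), of "v k 1" "v False 1"] faces z_left[of 1] True i1 m n2 by simp
    qed
  qed
  have u_const: "u k (P + i) = u False (P + 1)" if i: "1 \<le> i" "i \<le> m" for k i
  proof (cases "m = 1")
    case False
    then have "u l (P + 2) = u k (P + 1)" for k l
      using RR[of 1 2] i by simp
    moreover have "u k (P + i) = u False (P + 1)" if "1 < i"
      using RR[of 1 i] i that by simp
    ultimately show ?thesis
      using i by (metis le_neq_implies_less)
  next
    case True
    then have i1: "i = 1" and P1: "P = n - 1"
      using i P by (auto simp: m_def)
    have faces: "face A P l j (u k (P + 1)) = face A P l j (u False (P + 1))" if "1 \<le> j" "j \<le> P" for l j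
      using LR[of j 1 l k] LR[of j 1 l False] that True by simp
    show ?thesis
    proof (cases "n = 2")
      case False
      then have "2 \<le> P"
        using P1 n by simp
      then show ?thesis
        using two_coskeletalD(2)[OF A(3), of P "u k (P + 1)" "u False (P + 1)"] faces
          z_right[of 1] True i1 by simp
    next
      case n2: True
      then have "P = 1"
        using P1 by simp
      then have "label A (u k (P + 1)) = label A (u False (P + 1))"
        using zD(3)[OF n2, of 2 k False] z_right(1)[of 1] True by (simp add: HDA.label_tens numeral_2_eq_2)
      then show ?thesis
        using extensionalD[OF A(2), of "u k (P + 1)" "u False (P + 1)"] faces z_right[of 1] True i1
          \<open>P = 1\<close> by simp
    qed
  qed
  consider "P = n" "m = 0" | "P = 0" "m = n" | "1 \<le> P" "1 \<le> m"
    using P by (cases "P = 0"; cases "m = 0") (auto simp: m_def)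
  then show "\<exists>x \<in> Cubes ?AB n. \<forall>k i. 1 \<le> i \<and> i \<le> n \<longrightarrow> face ?AB n k i x = z k i"
  proof cases
    case 1
    have "boundary A R n u"
      unfolding boundary_def
    proof (intro conjI allI impI)
      fix k i
      assume "1 \<le> i \<and> i \<le> n"
      then show "u k i \<in> Cubes A (n - 1)"
        using z_left 1 by simp
    next
      fix k l i j
      assume "1 \<le> i \<and> i < j \<and> j \<le> n"
      then show "face A (n - 1) k i (u l j) = face A (n - 1) l (j - 1) (u k i)"
        using LL 1 by simp
    next
      assume n2: "n = 2"
      have "label ?AB (z k i) = Left (label A (u k i))" if "i = 1 \<or> i = 2" for k i
        using z_left(1)[of i k] that 1 n2 by (auto simp: HDA.label_tens)
      then show "label A (u False 2) = label A (u True 2)" "label A (u False 1) = label A (u True 1)"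
        "(label A (u False 2), label A (u False 1)) \<in> R"
        using zD(3)[OF n2, of 2 False True] zD(3)[OF n2, of 1 False True] zD(4)[OF n2, of False False]
        by simp_all
    qed
    then obtain x where x: "x \<in> Cubes A n" "\<And>k i. 1 \<le> i \<Longrightarrow> i \<le> n \<Longrightarrow> face A n k i x = u k i"
      using two_coskeletalD(3)[OF A(3) n] by blast
    \<comment> \<open>No direction belongs to the right factor, so the members of \<open>v\<close>
      are a single vertex of \<open>B\<close>, and only \<open>u\<close> had to be filled.\<close>
    have "face ?AB n k i (Pair n x 0 (v False 1)) = z k i" if "1 \<le> i" "i \<le> n" for k i
      using x z_left(1)[of i k] v_const[of i k] that 1 by (simp add: HDA.face_tens)
    moreover have "Pair n x 0 (v False 1) \<in> Cubes ?AB n"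
      using x z_left(3)[of 1] 1 n by (simp add: HDA.Cubes_tens)
    ultimately show ?thesis
      by blast
  next
    case 2
    have "boundary B Q n v"
      unfolding boundary_def
    proof (intro conjI allI impI)
      fix k i
      assume "1 \<le> i \<and> i \<le> n"
      then show "v k i \<in> Cubes B (n - 1)"
        using z_right(3)[of i k] 2 by simp
    next
      fix k l i j
      assume "1 \<le> i \<and> i < j \<and> j \<le> n"
      then show "face B (n - 1) k i (v l j) = face B (n - 1) l (j - 1) (v k i)"
        using RR[of i j l k] 2 by simp
    next
      assume n2: "n = 2"
      have "label ?AB (z k i) = Right (label B (v k i))" if "i = 1 \<or> i = 2" for k i
        using z_right(1)[of i k] that 2 n2 by (auto simp: HDA.label_tens)
      then show "label B (v False 2) = label B (v True 2)" "label B (v False 1) = label B (v True 1)"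
        "(label B (v False 2), label B (v False 1)) \<in> Q"
        using zD(3)[OF n2, of 2 False True] zD(3)[OF n2, of 1 False True] zD(4)[OF n2, of False False]
        by simp_all
    qed
    then obtain y where y: "y \<in> Cubes B n" "\<And>k i. 1 \<le> i \<Longrightarrow> i \<le> n \<Longrightarrow> face B n k i y = v k i"
      using two_coskeletalD(3)[OF B(3) n] by blast
    have "face ?AB n k i (Pair 0 (u False 1) n y) = z k i" if "1 \<le> i" "i \<le> n" for k i
      using y z_right(1)[of i k] u_const[of i k] that 2 by (simp add: HDA.face_tens)
    moreover have "Pair 0 (u False 1) n y \<in> Cubes ?AB n"
      using y z_right(2)[of 1] 2 n by (simp add: HDA.Cubes_tens)
    ultimately show ?thesis
      by blast
  next
    case 3
    \<comment> \<open>Nothing has to be filled: a facet in direction \<open>P + 1\<close> has a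
      first component of full degree \<open>P\<close>, a facet in direction 1 has a second component
      of full degree \<open>m\<close>, and \<open>LR\<close> computes their faces.\<close>
    let ?x = "Pair P (u False (P + 1)) m (v False 1)"
    have "face ?AB n k i ?x = z k i" if "1 \<le> i" "i \<le> n" for k i
    proof (cases "i \<le> P")
      case True
      then show ?thesis
        using LR[of i 1 k False] z_left(1)[of i k] v_const[of i k] that 3 by (simp add: HDA.face_tens)
    next
      case False
      then have "1 \<le> i - P" "i - P \<le> m" "P + (i - P) = i"
        using that by (auto simp: m_def)
      then show ?thesis
        using LR[of 1 "i - P" False k] z_right(1)[of "i - P" k] u_const[of "i - P" k] False 3
        by (simp add: HDA.face_tens)
    qed
    moreover have "?x \<in> Cubes ?AB n"
      using z_left(3)[of 1] z_right(2)[of 1] 3 P by (simp add: HDA.Cubes_tens m_def)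
    ultimately show ?thesis
      by blast
  qed
qed

section \<open>The structure isomorphisms\<close>

text \<open>
  \<open>unfold_cube X\<close> sends a cube of \<open>X\<close> to the iterated family of its faces: it is the unit of the
  2-coskeleton, which is the identity in degrees at most 1.
\<close>

primrec unfold_cube :: "'a el hda \<Rightarrow> nat \<Rightarrow> 'a el \<Rightarrow> 'a el" where
  "unfold_cube X 0 x = x"
| "unfold_cube X (Suc n) x =
     (if n = 0 then x else family (Suc n) (\<lambda>k i. unfold_cube X n (face X (Suc n) k i x)))"

lemma unfold_cube_low [simp]: "n \<le> 1 \<Longrightarrow> unfold_cube X n x = x"
  by (cases n) auto

lemma is_family_unfold_cube: "2 \<le> n \<Longrightarrow> is_family n (unfold_cube X n x)"
  by (cases n) auto

lemma entry_unfold_cube: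
  "\<lbrakk>2 \<le> n; 1 \<le> i; i \<le> n\<rbrakk> \<Longrightarrow>
    entry (unfold_cube X n x) k i = unfold_cube X (n - 1) (face X n k i x)"
  by (cases n) auto

definition canon :: "'a el hda \<Rightarrow> 'a el lts \<Rightarrow> ('a el hda, 'a el) mor" where
  "canon X T = mk_mor X (model T) (unfold_cube X) (\<lambda>a. a)"

lemma canon_simps [simp]:
  "src (canon X T) = X" "tgt (canon X T) = model T"
  "x \<in> Cubes X n \<Longrightarrow> on_cubes (canon X T) n x = unfold_cube X n x"
  "a \<in> Labels X \<Longrightarrow> on_labels (canon X T) a = a"
  by (simp_all add: canon_def)

text \<open>Literal agreement and not just an isomorphism: this allows the canonical map to be the
  identity on vertices, edges and labels.\<close>

definition same_skeleton :: "'a el hda \<Rightarrow> 'a el lts \<Rightarrow> bool" where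
  "same_skeleton X T \<longleftrightarrow> (\<forall>n \<le> 1. Cubes X n = Cubes T n) \<and>
     (\<forall>x \<in> Cubes X 1. \<forall>k. face X 1 k 1 x = face T 1 k 1 x) \<and>
     (\<forall>x \<in> Cubes X 1. label X x = label T x) \<and>
     Init X = Init T \<and> Final X = Final T \<and> Labels X = Labels T"

text \<open>Used for the tensor product of two models and for the unit HDA, so that both structure
  morphisms come from one construction.\<close>

locale coskeletal_automaton =
  fixes X :: "'a el hda" and T :: "'a el lts"
  assumes T: "is_lts T" and X: "is_hda X" "is_extensional X"
    and cosk: "two_coskeletal X (ltimes T)" and same: "same_skeleton X T"
begin

lemma skel:
  "n \<le> 1 \<Longrightarrow> Cubes X n = Cubes T n"
  "x \<in> Cubes X 1 \<Longrightarrow> face X 1 k 1 x = face T 1 k 1 x"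
  "x \<in> Cubes X 1 \<Longrightarrow> label X x = label T x"
  "Init X = Init T" "Final X = Final T" "Labels X = Labels T"
  using same by (auto simp: same_skeleton_def)

lemma is_hda_mor_canon: "is_hda_mor (canon X T)"
  unfolding canon_def
proof (rule mor_to_model[OF X(1)])
  show "\<And>x. x \<in> Cubes X 0 \<Longrightarrow> unfold_cube X 0 x \<in> Cubes T 0"
    "\<And>x. x \<in> Cubes X 1 \<Longrightarrow> unfold_cube X 1 x \<in> Cubes T 1"
    using skel(1)[of 0] skel(1)[of 1] by auto
  show "\<And>k x. x \<in> Cubes X 1 \<Longrightarrow> unfold_cube X 0 (face X 1 k 1 x) = face T 1 k 1 (unfold_cube X 1 x)"
    "\<And>x. x \<in> Cubes X 1 \<Longrightarrow> label T (unfold_cube X 1 x) = label X x"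
    using skel(2,3) by auto
  show "\<And>x. x \<in> Cubes X 2 \<Longrightarrow>
      (label X (face X 2 False 2 x), label X (face X 2 False 1 x)) \<in> ltimes T"
    using two_coskeletalD(1)[OF cosk] .
qed (use skel(4-6) is_family_unfold_cube entry_unfold_cube in auto)

lemma canon_Hom: "canon X T \<in> Hom HDA_ext X (model T)"
  using is_hda_mor_canon X model_ok[OF T] by (simp add: HDA_ext_eq HDA.Hom_moncat ok_HDA)

text \<open>Injectivity and surjectivity are uniqueness and existence of fillers in
  \<open>X\<close>. The induction is strong because degree \<open>n - 1\<close> is needed to pull
  facets back and degree \<open>n - 2\<close> to pull back their compatibility.\<close>

lemma bij_unfold_cube: "bij_betw (unfold_cube X n) (Cubes X n) (Cubes (model T) n)"
proof (induction n rule: less_induct)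
  case (less n)
  have mor: "unfold_cube X m x \<in> Cubes (model T) m" if "x \<in> Cubes X m" for m x
    using mor_cube[OF is_hda_mor_canon, of x m] that by simp
  have mor_d: "unfold_cube X (m - 1) (face X m k i x) = face (model T) m k i (unfold_cube X m x)"
    if "x \<in> Cubes X m" "1 \<le> i" "i \<le> m" for m k i x
    using mor_face[OF is_hda_mor_canon, of x m i k] hda_face[OF X(1) that] that by simp
  show ?case
  proof (cases "n \<le> 1")
    case True
    then have "bij_betw id (Cubes X n) (Cubes (model T) n)"
      using skel(1) by (simp add: Cubes_model_low)
    then show ?thesis
      by (rule bij_betw_cong[THEN iffD1, rotated]) (use True in simp)
  next
    case False
    then have n: "2 \<le> n" by simp
    have inj: "inj_on (unfold_cube X m) (Cubes X m)" if "m < n" for m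
      using less.IH[OF that] by (simp add: bij_betw_def)
    have img: "unfold_cube X (n - 1) ` Cubes X (n - 1) = Cubes (model T) (n - 1)"
      using less.IH[of "n - 1"] n by (simp add: bij_betw_def)
    have "inj_on (unfold_cube X n) (Cubes X n)"
    proof (rule inj_onI)
      fix x y
      assume xy: "x \<in> Cubes X n" "y \<in> Cubes X n" "unfold_cube X n x = unfold_cube X n y"
      show "x = y"
      proof (rule two_coskeletalD(2)[OF cosk n xy(1,2)])
        fix k i
        assume i: "1 \<le> i" "i \<le> n"
        have "unfold_cube X (n - 1) (face X n k i x) = unfold_cube X (n - 1) (face X n k i y)"
          using mor_d[OF xy(1) i] mor_d[OF xy(2) i] xy(3) by simp
        then show "face X n k i x = face X n k i y"
          using inj_onD[OF inj[of "n - 1"]] hda_face[OF X(1) xy(1) i] hda_face[OF X(1) xy(2) i] n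
          by simp
      qed
    qed
    moreover have "y \<in> unfold_cube X n ` Cubes X n" if y: "y \<in> Cubes (model T) n" for y
    proof -
      have fam: "is_family n y" and bd: "boundary (model T) (ltimes T) n (entry y)"
        using y n by (simp_all only: Cubes_model)
      \<comment> \<open>The facets of \<open>y\<close>, pulled back to \<open>X\<close>; once they
        are known to form a boundary, its filler is a preimage of \<open>y\<close>.\<close>
      define z where "z k i = inv_into (Cubes X (n - 1)) (unfold_cube X (n - 1)) (entry y k i)" for k i
      have z: "z k i \<in> Cubes X (n - 1)" "unfold_cube X (n - 1) (z k i) = entry y k i"
        if "1 \<le> i" "i \<le> n" for k i
        unfolding z_def
        using boundaryD(1)[OF bd that, of k] img
        by (metis inv_into_into, metis f_inv_into_f)
      have "boundary X (ltimes T) n z"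
        unfolding boundary_def
      proof (intro conjI allI impI)
        fix k i
        assume "1 \<le> i \<and> i \<le> n"
        then show "z k i \<in> Cubes X (n - 1)"
          using z by simp
      next
        fix k l i j
        assume ij: "1 \<le> i \<and> i < j \<and> j \<le> n"
        then have ij': "1 \<le> i" "i \<le> n" "i \<le> n - 1" "1 \<le> j" "j \<le> n" "1 \<le> j - 1" "j - 1 \<le> n - 1"
          by auto
        \<comment> \<open>The identity is first proved after application of
          \<open>unfold_cube\<close> in degree \<open>n - 2\<close>, which is injective by the
          induction hypothesis.\<close>
        have "unfold_cube X (n - 1 - 1) (face X (n - 1) k i (z l j)) =
            face (model T) (n - 1) k i (entry y l j)"
          using mor_d[OF z(1)[OF ij'(4,5)] ij'(1,3), of k l] z(2)[OF ij'(4,5)] by simp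
        also have "\<dots> = face (model T) (n - 1) l (j - 1) (entry y k i)"
          using boundaryD(2)[OF bd] ij by simp
        also have "\<dots> = unfold_cube X (n - 1 - 1) (face X (n - 1) l (j - 1) (z k i))"
          using mor_d[OF z(1)[OF ij'(1,2)] ij'(6,7), of l k] z(2)[OF ij'(1,2)] by simp
        finally show "face X (n - 1) k i (z l j) = face X (n - 1) l (j - 1) (z k i)"
          using inj_onD[OF inj[of "n - 1 - 1"]] n hda_face[OF X(1) z(1)[OF ij'(4,5)] ij'(1,3)]
            hda_face[OF X(1) z(1)[OF ij'(1,2)] ij'(6,7)] by simp
      next
        assume n2: "n = 2"
        \<comment> \<open>On edges \<open>unfold_cube\<close> is the identity, so \<open>z\<close>
          inherits the admissibility of \<open>y\<close>.\<close>
        have zy: "z k i = entry y k i" "label X (z k i) = label (model T) (entry y k i)"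
          if "i = 1 \<or> i = 2" for k i
        proof -
          show "z k i = entry y k i"
            using z(2)[of i k] that n2 by auto
          then show "label X (z k i) = label (model T) (entry y k i)"
            using z(1)[of i k] that n2 skel(3) by auto
        qed
        show "label X (z False 2) = label X (z True 2)" "label X (z False 1) = label X (z True 1)"
          "(label X (z False 2), label X (z False 1)) \<in> ltimes T"
          using zy boundaryD(3)[OF bd n2, of 2 False True] boundaryD(3)[OF bd n2, of 1 False True]
            boundaryD(4)[OF bd n2, of False False] by simp_all
      qed
      then obtain x where x: "x \<in> Cubes X n" "\<And>k i. 1 \<le> i \<Longrightarrow> i \<le> n \<Longrightarrow> face X n k i x = z k i"
        using two_coskeletalD(3)[OF cosk n] by blast
      have "unfold_cube X n x = y"
        by (rule is_family_eqI[OF is_family_unfold_cube[OF n] fam])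
          (use z(2) in \<open>simp add: x(2) entry_unfold_cube n\<close>)
      then show ?thesis
        using x(1) by blast
    qed
    moreover have "unfold_cube X n ` Cubes X n \<subseteq> Cubes (model T) n"
      using mor by blast
    ultimately show ?thesis
      unfolding bij_betw_def by blast
  qed
qed

lemma canon_iso: "is_iso HDA_ext (canon X T)"
  unfolding HDA_ext_eq
proof (rule HDA.is_iso_moncatI[OF canon_Hom[unfolded HDA_ext_eq]])
  show "bij_betw (on_cubes (canon X T) n) (Cubes X n) (Cubes (model T) n)" for n
    using bij_unfold_cube by (rule bij_betw_cong[THEN iffD1, rotated]) simp
  have "bij_betw (on_labels (canon X T)) (Labels X) (Labels (model T)) \<longleftrightarrow>
      bij_betw id (Labels X) (Labels (model T))"
    by (intro bij_betw_cong) simp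
  then show "bij_betw (on_labels (canon X T)) (Labels X) (Labels (model T))"
    by (simp add: skel)
  show "Final (model T) \<subseteq> on_cubes (canon X T) 0 ` Final X"
    using hda_Final[OF X(1)] by (force simp: skel(5))
qed auto

end

section \<open>The instances: tensor products of models and the unit\<close>

lemma lts_tensor: "is_lts S \<Longrightarrow> is_lts T \<Longrightarrow> is_lts (interleave S T)"
  using TS.tens_ok by (simp add: ok_TS)

lemma Cubes_tensor_model:
  assumes "n \<le> 1"
  shows "Cubes (tensor (model S) (model T)) n = Cubes (interleave S T) n"
  using assms by (auto simp: HDA.Cubes_tens TS.Cubes_tens Cubes_model_low)

lemma coskeletal_tensor:
  assumes S: "is_lts S" and T: "is_lts T"
  shows "coskeletal_automaton (tensor (model S) (model T)) (interleave S T)"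
proof
  show "is_lts (interleave S T)"
    using lts_tensor S T .
  note okS = model_ok[OF S] and okT = model_ok[OF T]
  show "is_hda (tensor (model S) (model T))" "is_extensional (tensor (model S) (model T))"
    using HDA.tens_ok[OF okS okT] by (simp_all add: ok_HDA)
  show "two_coskeletal (tensor (model S) (model T)) (ltimes (interleave S T))"
    using two_coskeletal_tensor[OF _ _ two_coskeletal_model _ _ two_coskeletal_model, of S T] okS okT
    by (simp add: ok_HDA ltimes_interleave)
  show "same_skeleton (tensor (model S) (model T)) (interleave S T)"
    unfolding same_skeleton_def
  proof (intro conjI ballI allI impI)
    fix x k
    assume "x \<in> Cubes (tensor (model S) (model T)) 1"
    then show "face (tensor (model S) (model T)) 1 k 1 x = face (interleave S T) 1 k 1 x"
      "label (tensor (model S) (model T)) x = label (interleave S T) x"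
      by (auto elim!: Cubes_tensorE simp: HDA.face_tens TS.face_tens HDA.label_tens TS.label_tens face_model)
  qed (simp_all add: Cubes_tensor_model HDA.Init_tens HDA.Final_tens HDA.Labels_tens
      TS.Init_tens TS.Final_tens TS.Labels_tens)
qed

lemma coskeletal_unit: "coskeletal_automaton unit_hda unit_lts"
proof
  show "is_lts unit_lts"
    using TS.unt_ok by (simp add: ok_TS)
  show "is_hda unit_hda" "is_extensional unit_hda"
    by (rule HDA.unt_ok[unfolded ok_HDA, THEN conjunct1] HDA.unt_ok[unfolded ok_HDA, THEN conjunct2])+
  \<comment> \<open>In dimension at least 2 the unit has no cubes that could serve as
    facets.\<close>
  have "\<not> boundary unit_hda R n z" if "2 \<le> n" for R n z
    using that boundaryD(1)[of unit_hda R n z 1] by (auto simp: HDA.Cubes_unt)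
  then show "two_coskeletal unit_hda (ltimes unit_lts)"
    by (auto simp: two_coskeletal_def HDA.Cubes_unt)
  show "same_skeleton unit_hda unit_lts"
    by (simp add: same_skeleton_def HDA.Cubes_unt TS.Cubes_unt HDA.Init_unt TS.Init_unt
        HDA.Final_unt TS.Final_unt HDA.Labels_unt TS.Labels_unt)
qed

section \<open>The model functor is strong monoidal\<close>

lemma map_obj_model: "map_obj HDA_model T = model T"
  by (simp add: HDA_model_def functor_comp_def Gamma2_def Psi_def model_def)

lemma map_arr_model:
  "map_arr HDA_model f = mk_mor (model (src f)) (model (tgt f))
     (cosk_map (on_cubes (map_arr Psi f))) (on_labels (map_arr Psi f))"
  by (simp add: HDA_model_def functor_comp_def Gamma2_def Psi_def model_def)

lemma entry_map_family:
  "is_family n x \<Longrightarrow> 1 \<le> i \<Longrightarrow> i \<le> n \<Longrightarrow> entry (map_family f x) k i = f (entry x k i)"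
  by (auto simp: is_family_def)

lemma is_family_map_family: "is_family n x \<Longrightarrow> is_family n (map_family f x)"
  by (auto simp: is_family_def)

lemma map_arr_model_low:
  assumes "n \<le> 1" "x \<in> Cubes (src f) n"
  shows "on_cubes (map_arr HDA_model f) n x = on_cubes f n x"
proof -
  have "cosk_map (on_cubes (map_arr Psi f)) n = on_cubes (map_arr Psi f) n"
    using assms(1) by (cases n) auto
  moreover have "x \<in> Cubes (Psi_obj (src f)) n"
    using assms by (simp add: Psi_obj_def)
  ultimately show ?thesis
    using assms by (simp add: map_arr_model Cubes_model_low Psi_def)
qed

lemma map_arr_model_labels:
  assumes "a \<in> Labels (src f)"
  shows "on_labels (map_arr HDA_model f) a = on_labels f a"
proof -
  have "a \<in> Labels (Psi_obj (src f))"
    using assms by (simp add: Psi_obj_def hda.defs)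
  then show ?thesis
    using assms by (simp add: map_arr_model Psi_def)
qed

lemma map_arr_model_Hom:
  assumes f: "f \<in> Hom TS_ltimes S T"
  shows "map_arr HDA_model f \<in> Hom HDA_ext (model S) (model T)"
proof -
  note fD = TS.HomD[OF f[unfolded TS_ltimes_eq], unfolded ok_TS]
  note mD = is_hda_morD[OF fD(5), unfolded fD(1,2)]
  let ?g = "cosk_map (on_cubes (map_arr Psi f))" and ?s = "on_labels (map_arr Psi f)"
  have g_low: "?g n x = on_cubes f n x" if "n \<le> 1" "x \<in> Cubes S n" for n x
    using map_arr_model_low[of n x f] that fD(1) by (simp add: map_arr_model Cubes_model_low)
  have s: "?s a = on_labels f a" if "a \<in> Labels S" for a
    using map_arr_model_labels[of a f] that fD(1) by (simp add: map_arr_model)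
  \<comment> \<open>Degree 2 is handled by \<open>Psi\<close> and higher degrees by the coskeleton,
    but in both cases some \<open>h\<close> that agrees with \<open>?g\<close> on the cubes of
    degree \<open>n - 1\<close> is applied to all members of the family. This yields the condition
    on entries in \<open>mor_to_model\<close>.\<close>
  have g_high: "\<exists>h. ?g n x = map_family h x \<and> (\<forall>y \<in> Cubes (model S) (n - 1). h y = ?g (n - 1) y)"
    if n: "2 \<le> n" and x: "x \<in> Cubes (model S) n" for n x
  proof (cases "n = 2")
    case True
    then have "x \<in> Cubes (Psi_obj S) 2"
      using x by (simp add: model_def Gamma2_obj_def numeral_2_eq_2)
    then have "?g n x = map_family (on_cubes f 1) x"
      using True fD(1) by (simp add: Psi_def numeral_2_eq_2)
    then show ?thesis
      using True g_low[of 1] by (intro exI[of _ "on_cubes f 1"]) (simp add: Cubes_model_low)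
  next
    case False
    then obtain m where "n = Suc m" "2 \<le> m"
      using n by (cases n) auto
    then show ?thesis
      by auto
  qed
  have "is_hda_mor (mk_mor (model S) (model T) ?g ?s)"
  proof (rule mor_to_model[OF is_hda_model[OF fD(3)]])
    show "?g 0 x \<in> Cubes T 0" if "x \<in> Cubes (model S) 0" for x
      using that mD(2) g_low[of 0 x] by (simp add: Cubes_model_low)
    show "?g 1 x \<in> Cubes T 1" if "x \<in> Cubes (model S) 1" for x
      using that mD(2) g_low[of 1 x] by (simp add: Cubes_model_low)
    show "?g 0 (face (model S) 1 k 1 x) = face T 1 k 1 (?g 1 x)" if "x \<in> Cubes (model S) 1" for k x
      using that mD(3)[of x 1 1 k] g_low[of 1 x] g_low[of 0 "face S 1 k 1 x"] hda_face[of S x 1 1 k]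
        fD(3) by (simp add: Cubes_model_low face_model is_lts_def is_transition_system_def)
    show "?g 0 (Init (model S)) = Init T" "\<And>x. x \<in> Final (model S) \<Longrightarrow> ?g 0 x \<in> Final T"
      using mD(4,5) g_low[of 0] hda_Init[of S] hda_Final[of S] fD(3)
      by (simp_all add: is_lts_def is_transition_system_def)
    show "?s a \<in> Labels T" if "a \<in> Labels (model S)" for a
      using s that mD(7) by simp
    show "label T (?g 1 x) = ?s (label (model S) x)" if "x \<in> Cubes (model S) 1" for x
      using that g_low[of 1 x] s mD(8)[of x] hda_label[of S x] fD(3)
      by (simp add: Cubes_model_low is_lts_def is_transition_system_def)
    \<comment> \<open>Here the preservation of \<ltimes> by \<open>f\<close> enters: it keeps the
      image of an independence square admissible.\<close>
    show "(?s (label (model S) (face (model S) 2 False 2 x)),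
        ?s (label (model S) (face (model S) 2 False 1 x))) \<in> ltimes T"
      if "x \<in> Cubes (model S) 2" for x
      using two_coskeletalD(1)[OF two_coskeletal_model that] fD(3,9) s
      by (auto simp: is_lts_def)
    fix n x
    assume n: "2 \<le> n" and x: "x \<in> Cubes (model S) n"
    have fam: "is_family n x" and bd: "boundary (model S) (ltimes S) n (entry x)"
      using x n by (simp_all only: Cubes_model)
    obtain h where h: "?g n x = map_family h x" "\<And>y. y \<in> Cubes (model S) (n - 1) \<Longrightarrow> h y = ?g (n - 1) y"
      using g_high[OF n x] by blast
    show "is_family n (?g n x)"
      unfolding h(1) using fam by (rule is_family_map_family)
    fix k i
    assume i: "1 \<le> i" "i \<le> n"
    show "entry (?g n x) k i = ?g (n - 1) (face (model S) n k i x)"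
      using h entry_map_family[OF fam i, of h k] boundaryD(1)[OF bd i, of k] n
      by (simp add: face_model)
  qed
  then show ?thesis
    using model_ok[OF fD(3)] model_ok[OF fD(4)] fD by (simp add: map_arr_model HDA_ext_eq HDA.Hom_moncat)
qed

section \<open>Comparison of morphisms into a model\<close>

lemma HDA_HomD:
  assumes "f \<in> Hom HDA_ext X Y"
  shows "src f = X" "tgt f = Y" "is_hda X" "is_hda_mor f"
  using assms by (auto simp: HDA_ext_eq HDA.Hom_moncat ok_HDA)

text \<open>The functor laws and coherence diagrams all end in a model, so they reduce to vertices,
  edges and labels. There the functor does not change a morphism, and the structure morphisms are
  identities.\<close>

lemma Hom_model_eqI:
  assumes f: "f \<in> Hom HDA_ext X (model T)" and g: "g \<in> Hom HDA_ext X (model T)"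
    and "\<And>n x. n \<le> 1 \<Longrightarrow> x \<in> Cubes X n \<Longrightarrow> on_cubes f n x = on_cubes g n x"
    and "\<And>a. a \<in> Labels X \<Longrightarrow> on_labels f a = on_labels g a"
  shows "f = g"
  using HDA_HomD[OF f] HDA_HomD[OF g] assms(3,4) by (intro mor_to_model_eqI[of f g X T]) auto


definition model_mult :: "'a el lts \<Rightarrow> 'a el lts \<Rightarrow> ('a el hda, 'a el) mor" where
  "model_mult S T = canon (tensor (model S) (model T)) (interleave S T)"

definition model_unit :: "('a el hda, 'a el) mor" where
  "model_unit = canon unit_hda unit_lts"

lemma model_mult_Hom:
  "is_lts S \<Longrightarrow> is_lts T \<Longrightarrow>
    model_mult S T \<in> Hom HDA_ext (tensor (model S) (model T)) (model (interleave S T))"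
  unfolding model_mult_def by (rule coskeletal_automaton.canon_Hom[OF coskeletal_tensor])

lemma model_mult_simps [simp]:
  "src (model_mult S T) = tensor (model S) (model T)"
  "tgt (model_mult S T) = model (interleave S T)"
  "n \<le> 1 \<Longrightarrow> x \<in> Cubes (tensor (model S) (model T)) n \<Longrightarrow> on_cubes (model_mult S T) n x = x"
  "a \<in> Labels (tensor (model S) (model T)) \<Longrightarrow> on_labels (model_mult S T) a = a"
  by (simp_all add: model_mult_def)

lemma model_unit_Hom: "model_unit \<in> Hom HDA_ext unit_hda (model unit_lts)"
  unfolding model_unit_def by (rule coskeletal_automaton.canon_Hom[OF coskeletal_unit])

lemma model_unit_simps [simp]:
  "src model_unit = unit_hda" "tgt model_unit = model unit_lts"
  "n \<le> 1 \<Longrightarrow> x \<in> Cubes unit_hda n \<Longrightarrow> on_cubes model_unit n x = x"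
  by (simp_all add: model_unit_def)

lemma HDA_simps:
  "Id HDA_ext = id_mor" "Comp HDA_ext = comp_mor" "Tens_obj HDA_ext = tensor"
  "Tens_arr HDA_ext = tensor_mor tensor" "Unit HDA_ext = unit_hda"
  "Assoc HDA_ext = HDA.assoc_mor" "Lunit HDA_ext = HDA.lunit_mor" "Runit HDA_ext = HDA.runit_mor"
  by (simp_all add: HDA_ext_eq)

lemma TS_simps:
  "Obj TS_ltimes = {T. is_lts T}"
  "Id TS_ltimes = id_mor" "Comp TS_ltimes = comp_mor" "Tens_obj TS_ltimes = interleave"
  "Tens_arr TS_ltimes = tensor_mor interleave" "Unit TS_ltimes = unit_lts"
  "Assoc TS_ltimes = TS.assoc_mor" "Lunit TS_ltimes = TS.lunit_mor" "Runit TS_ltimes = TS.runit_mor"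
  by (simp_all add: TS_ltimes_eq ok_TS)

lemmas HDA_id_Hom = HDA.id_Hom[folded HDA_ext_eq]
  and HDA_comp_Hom = HDA.comp_Hom[folded HDA_ext_eq]
  and HDA_tens_Hom = HDA.tens_Hom[folded HDA_ext_eq]
  and HDA_assoc_Hom = HDA.assoc_Hom[folded HDA_ext_eq]
  and HDA_lunit_Hom = HDA.lunit_Hom[folded HDA_ext_eq]
  and HDA_runit_Hom = HDA.runit_Hom[folded HDA_ext_eq]

lemmas TS_HomD = TS.HomD[folded TS_ltimes_eq, unfolded ok_TS]
lemmas TS_id_Hom = TS.id_Hom[folded TS_ltimes_eq, unfolded ok_TS]
  and TS_comp_Hom = TS.comp_Hom[folded TS_ltimes_eq, unfolded ok_TS]
  and TS_tens_Hom = TS.tens_Hom[folded TS_ltimes_eq, unfolded ok_TS]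
  and TS_assoc_Hom = TS.assoc_Hom[folded TS_ltimes_eq, unfolded ok_TS]
  and TS_lunit_Hom = TS.lunit_Hom[folded TS_ltimes_eq, unfolded ok_TS]
  and TS_runit_Hom = TS.runit_Hom[folded TS_ltimes_eq, unfolded ok_TS]

lemma is_lts_unit: "is_lts unit_lts"
  using TS.unt_ok by (simp add: ok_TS)

lemma category_functor_model: "category_functor TS_ltimes HDA_ext HDA_model"
proof (intro category_functor.intro category_functor_axioms.intro)
  show "category TS_ltimes" "category HDA_ext"
    unfolding TS_ltimes_eq HDA_ext_eq by (rule TS.category_moncat HDA.category_moncat)+
  show "map_obj HDA_model X \<in> Obj HDA_ext" if "X \<in> Obj TS_ltimes" for X
    using that model_ok[of X] by (simp add: TS_simps map_obj_model HDA_ext_eq)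
  show "map_arr HDA_model f \<in> Hom HDA_ext (map_obj HDA_model X) (map_obj HDA_model Y)"
    if "f \<in> Hom TS_ltimes X Y" for f X Y
    using map_arr_model_Hom[OF that] by (simp add: map_obj_model)
  show "map_arr HDA_model (Id TS_ltimes X) = Id HDA_ext (map_obj HDA_model X)"
    if "X \<in> Obj TS_ltimes" for X
  proof -
    have X: "is_lts X"
      using that by (simp add: TS_simps)
    show ?thesis
      unfolding TS_simps HDA_simps map_obj_model
      by (rule Hom_model_eqI[OF map_arr_model_Hom[OF TS_id_Hom[OF X]] HDA_id_Hom[OF model_ok[OF X]]])
        (simp_all add: map_arr_model_low map_arr_model_labels Cubes_model_low)
  qed
  show "map_arr HDA_model (Comp TS_ltimes g f) = Comp HDA_ext (map_arr HDA_model g) (map_arr HDA_model f)"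
    if f: "f \<in> Hom TS_ltimes X Y" and g: "g \<in> Hom TS_ltimes Y Z" for f g X Y Z
    unfolding TS_simps HDA_simps
    by (rule Hom_model_eqI[OF map_arr_model_Hom[OF TS_comp_Hom[OF f g]]
          HDA_comp_Hom[OF map_arr_model_Hom[OF f] map_arr_model_Hom[OF g]]])
      (use TS_HomD[OF f] TS_HomD[OF g] HDA_HomD(1,2)[OF map_arr_model_Hom[OF f]]
       in \<open>simp_all add: map_arr_model_low map_arr_model_labels Cubes_model_low\<close>)
qed

section \<open>Naturality and coherence of the structure isomorphisms\<close>

lemma low_pair:
  fixes A B :: "'a el hda"
  assumes "x \<in> Cubes (tensor A B) n" "n \<le> 1"
  obtains p a q b where "p + q = n" "p \<le> 1" "q \<le> 1" "x = Pair p a q b"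
    "a \<in> Cubes A p" "b \<in> Cubes B q"
  using assms by (auto simp: HDA.Cubes_tens)

text \<open>In degrees at most 1 both composites act componentwise by \<open>f\<close> and
  \<open>g\<close>.\<close>

lemma model_mult_natural:
  assumes f: "f \<in> Hom TS_ltimes S S'" and g: "g \<in> Hom TS_ltimes T T'"
  shows "comp_mor (model_mult S' T') (tensor_mor tensor (map_arr HDA_model f) (map_arr HDA_model g)) =
    comp_mor (map_arr HDA_model (tensor_mor interleave f g)) (model_mult S T)"
proof (rule Hom_model_eqI)
  note fD = TS_HomD[OF f] and gD = TS_HomD[OF g]
  note Ff = map_arr_model_Hom[OF f] and Fg = map_arr_model_Hom[OF g]
  show "comp_mor (model_mult S' T') (tensor_mor tensor (map_arr HDA_model f) (map_arr HDA_model g))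
      \<in> Hom HDA_ext (tensor (model S) (model T)) (model (interleave S' T'))"
    using HDA_comp_Hom[OF HDA_tens_Hom[OF Ff Fg] model_mult_Hom[OF fD(4) gD(4)]] .
  show "comp_mor (map_arr HDA_model (tensor_mor interleave f g)) (model_mult S T)
      \<in> Hom HDA_ext (tensor (model S) (model T)) (model (interleave S' T'))"
    using HDA_comp_Hom[OF model_mult_Hom[OF fD(3) gD(3)] map_arr_model_Hom[OF TS_tens_Hom[OF f g]]] .
  note src = fD(1,2) gD(1,2) HDA_HomD(1)[OF Ff] HDA_HomD(1)[OF Fg]
  fix n x
  assume n: "n \<le> 1" and x: "x \<in> Cubes (tensor (model S) (model T)) n"
  obtain p a q b where pq: "p + q = n" "p \<le> 1" "q \<le> 1" "x = Pair p a q b"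
    "a \<in> Cubes (model S) p" "b \<in> Cubes (model T) q"
    using low_pair[OF x n] .
  then have ab: "a \<in> Cubes S p" "b \<in> Cubes T q"
    by (simp_all add: Cubes_model_low)
  have x': "Pair p a q b \<in> Cubes (interleave S T) n"
    using Cubes_tensor_model[OF n, of S T] x pq by simp
  have y: "Pair p (on_cubes f p a) q (on_cubes g q b) \<in> Cubes (tensor (model S') (model T')) n"
    using pq ab fD(7) gD(7) by (simp add: HDA.Cubes_tens Cubes_model_low)
  show "on_cubes (comp_mor (model_mult S' T')
        (tensor_mor tensor (map_arr HDA_model f) (map_arr HDA_model g))) n x =
      on_cubes (comp_mor (map_arr HDA_model (tensor_mor interleave f g)) (model_mult S T)) n x"
    using n x x' y pq ab src by (simp add: map_arr_model_low)
next
  note fD = TS_HomD[OF f] and gD = TS_HomD[OF g]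
  note src = fD(1,2) gD(1,2) HDA_HomD(1)[OF map_arr_model_Hom[OF f]] HDA_HomD(1)[OF map_arr_model_Hom[OF g]]
  fix a
  assume "a \<in> Labels (tensor (model S) (model T))"
  then show "on_labels (comp_mor (model_mult S' T')
        (tensor_mor tensor (map_arr HDA_model f) (map_arr HDA_model g))) a =
      on_labels (comp_mor (map_arr HDA_model (tensor_mor interleave f g)) (model_mult S T)) a"
    using src fD(8) gD(8)
    by (auto simp: HDA.Labels_tens TS.Labels_tens map_arr_model_labels)
qed

lemma model_mult_assoc:
  assumes R: "is_lts R" and S: "is_lts S" and T: "is_lts T"
  shows "comp_mor (map_arr HDA_model (TS.assoc_mor R S T))
      (comp_mor (model_mult (interleave R S) T) (tensor_mor tensor (model_mult R S) (id_mor (model T)))) =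
    comp_mor (model_mult R (interleave S T))
      (comp_mor (tensor_mor tensor (id_mor (model R)) (model_mult S T))
        (HDA.assoc_mor (model R) (model S) (model T)))" (is "?f = ?g")
proof (rule Hom_model_eqI)
  note ok = model_ok[OF R] model_ok[OF S] model_ok[OF T]
  note RS = lts_tensor[OF R S] and ST = lts_tensor[OF S T]
  let ?X = "tensor (tensor (model R) (model S)) (model T)"
  show "?f \<in> Hom HDA_ext ?X (model (interleave R (interleave S T)))"
    by (rule HDA_comp_Hom[OF HDA_comp_Hom[OF HDA_tens_Hom[OF model_mult_Hom[OF R S] HDA_id_Hom[OF ok(3)]]
            model_mult_Hom[OF RS T]] map_arr_model_Hom[OF TS_assoc_Hom[OF R S T]]])
  show "?g \<in> Hom HDA_ext ?X (model (interleave R (interleave S T)))"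
    by (rule HDA_comp_Hom[OF HDA_comp_Hom[OF HDA_assoc_Hom[OF ok]
            HDA_tens_Hom[OF HDA_id_Hom[OF ok(1)] model_mult_Hom[OF S T]]] model_mult_Hom[OF R ST]])
  have src: "src (map_arr HDA_model (TS.assoc_mor R S T)) = model (interleave (interleave R S) T)"
    by (simp add: map_arr_model)
  fix n x
  assume n: "n \<le> 1" and x: "x \<in> Cubes ?X n"
  obtain m y r c where mr: "m + r = n" "m \<le> 1" "r \<le> 1" "x = Pair m y r c"
    "y \<in> Cubes (tensor (model R) (model S)) m" "c \<in> Cubes (model T) r"
    using low_pair[OF x n] .
  obtain p a q b where pq: "p + q = m" "p \<le> 1" "q \<le> 1" "y = Pair p a q b"
    "a \<in> Cubes (model R) p" "b \<in> Cubes (model S) q"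
    using low_pair[OF mr(5,2)] .
  note mem = mr(1-3,6) pq(1-3,5,6) n
  \<comment> \<open>The two composites pass through different tensor products and interleavings. In
    degrees at most 1 the elements they produce are cubes of all of these, so each map can be
    evaluated.\<close>
  have "x \<in> Cubes (tensor (model (interleave R S)) (model T)) n"
    "x \<in> Cubes (interleave (interleave R S) T) n"
    "Pair p a q b \<in> Cubes (tensor (model R) (model S)) m"
    "Pair q b r c \<in> Cubes (tensor (model S) (model T)) (q + r)"
    "Pair p a (q + r) (Pair q b r c) \<in> Cubes (tensor (model R) (tensor (model S) (model T))) n"
    "Pair p a (q + r) (Pair q b r c) \<in> Cubes (tensor (model R) (model (interleave S T))) n"
    "q + r \<le> 1"
    using mem by (auto simp: mr(4) pq(4) HDA.Cubes_tens TS.Cubes_tens Cubes_model_low)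
  then show "on_cubes ?f n x = on_cubes ?g n x"
    using mem x src by (simp add: mr(4) pq(4) map_arr_model_low)
next
  fix a
  assume "a \<in> Labels (tensor (tensor (model R) (model S)) (model T))"
  moreover have "src (map_arr HDA_model (TS.assoc_mor R S T)) = model (interleave (interleave R S) T)"
    by (simp add: map_arr_model)
  ultimately show "on_labels ?f a = on_labels ?g a"
    by (auto simp: HDA.Labels_tens TS.Labels_tens map_arr_model_labels)
qed

lemma model_mult_lunit:
  assumes T: "is_lts T"
  shows "comp_mor (map_arr HDA_model (TS.lunit_mor T))
      (comp_mor (model_mult unit_lts T) (tensor_mor tensor model_unit (id_mor (model T)))) =
    HDA.lunit_mor (model T)" (is "?f = ?g")
proof (rule Hom_model_eqI)
  note ok = model_ok[OF T]
  let ?X = "tensor unit_hda (model T)"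
  show "?f \<in> Hom HDA_ext ?X (model T)"
    by (rule HDA_comp_Hom[OF HDA_comp_Hom[OF HDA_tens_Hom[OF model_unit_Hom HDA_id_Hom[OF ok]]
            model_mult_Hom[OF is_lts_unit T]] map_arr_model_Hom[OF TS_lunit_Hom[OF T]]])
  show "?g \<in> Hom HDA_ext ?X (model T)"
    by (rule HDA_lunit_Hom[OF ok])
  fix n x
  assume n: "n \<le> 1" and x: "x \<in> Cubes ?X n"
  obtain p a q b where pq: "p + q = n" "p \<le> 1" "q \<le> 1" "x = Pair p a q b"
    "a \<in> Cubes unit_hda p" "b \<in> Cubes (model T) q"
    using low_pair[OF x n] .
  note mem = pq(1-3,5,6) n
  have "x \<in> Cubes (tensor (model unit_lts) (model T)) n" "x \<in> Cubes (interleave unit_lts T) n"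
    using mem by (auto simp: pq(4) HDA.Cubes_tens TS.Cubes_tens Cubes_model_low HDA.Cubes_unt
        TS.Cubes_unt split: if_splits)
  then show "on_cubes ?f n x = on_cubes ?g n x"
    using mem x by (simp add: pq(4) map_arr_model_low)
next
  fix a
  assume "a \<in> Labels (tensor unit_hda (model T))"
  then show "on_labels ?f a = on_labels ?g a"
    by (auto simp: HDA.Labels_tens TS.Labels_tens HDA.Labels_unt map_arr_model_labels)
qed

lemma model_mult_runit:
  assumes T: "is_lts T"
  shows "comp_mor (map_arr HDA_model (TS.runit_mor T))
      (comp_mor (model_mult T unit_lts) (tensor_mor tensor (id_mor (model T)) model_unit)) =
    HDA.runit_mor (model T)" (is "?f = ?g")
proof (rule Hom_model_eqI)
  note ok = model_ok[OF T]
  let ?X = "tensor (model T) unit_hda"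
  show "?f \<in> Hom HDA_ext ?X (model T)"
    by (rule HDA_comp_Hom[OF HDA_comp_Hom[OF HDA_tens_Hom[OF HDA_id_Hom[OF ok] model_unit_Hom]
            model_mult_Hom[OF T is_lts_unit]] map_arr_model_Hom[OF TS_runit_Hom[OF T]]])
  show "?g \<in> Hom HDA_ext ?X (model T)"
    by (rule HDA_runit_Hom[OF ok])
  fix n x
  assume n: "n \<le> 1" and x: "x \<in> Cubes ?X n"
  obtain p a q b where pq: "p + q = n" "p \<le> 1" "q \<le> 1" "x = Pair p a q b"
    "a \<in> Cubes (model T) p" "b \<in> Cubes unit_hda q"
    using low_pair[OF x n] .
  note mem = pq(1-3,5,6) n
  have "x \<in> Cubes (tensor (model T) (model unit_lts)) n" "x \<in> Cubes (interleave T unit_lts) n"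
    using mem by (auto simp: pq(4) HDA.Cubes_tens TS.Cubes_tens Cubes_model_low HDA.Cubes_unt
        TS.Cubes_unt split: if_splits)
  then show "on_cubes ?f n x = on_cubes ?g n x"
    using mem x by (simp add: pq(4) map_arr_model_low)
next
  fix a
  assume "a \<in> Labels (tensor (model T) unit_hda)"
  then show "on_labels ?f a = on_labels ?g a"
    by (auto simp: HDA.Labels_tens TS.Labels_tens HDA.Labels_unt map_arr_model_labels)
qed

lemma model_mult_iso: "is_lts S \<Longrightarrow> is_lts T \<Longrightarrow> is_iso HDA_ext (model_mult S T)"
  unfolding model_mult_def by (rule coskeletal_automaton.canon_iso[OF coskeletal_tensor])

lemma model_unit_iso: "is_iso HDA_ext model_unit"
  unfolding model_unit_def by (rule coskeletal_automaton.canon_iso[OF coskeletal_unit])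

lemma strong_monoidal_functor_model:
  "strong_monoidal_functor TS_ltimes HDA_ext HDA_model model_mult model_unit"
proof (intro strong_monoidal_functor.intro category_functor_model
    strong_monoidal_functor_axioms.intro)
  show "monoidal_category TS_ltimes" "monoidal_category HDA_ext"
    unfolding TS_ltimes_eq HDA_ext_eq
    by (rule TS.monoidal_category_moncat HDA.monoidal_category_moncat)+
qed (simp_all only: TS_simps HDA_simps map_obj_model mem_Collect_eq model_mult_Hom model_mult_iso
    model_mult_natural model_unit_Hom model_unit_iso model_mult_assoc model_mult_lunit
    model_mult_runit)

section \<open>Uniqueness of the structure isomorphisms\<close>

lemma restricts_to_identity_low:
  assumes "restricts_to_identity f (hda.truncate (interleave S T))"
  shows "n \<le> 1 \<Longrightarrow> x \<in> Cubes (tensor (model S) (model T)) n \<Longrightarrow> on_cubes f n x = x"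
    "a \<in> Labels (tensor (model S) (model T)) \<Longrightarrow> on_labels f a = a"
  using assms Cubes_tensor_model[of n S T]
  by (auto simp: restricts_to_identity_def hda.defs HDA.Labels_tens TS.Labels_tens)

lemma is_structure_iso_model_mult:
  assumes "is_lts S" "is_lts T"
  shows "is_structure_iso S T (model_mult S T)"
proof -
  \<comment> \<open>\<open>restricts_to_identity\<close> ranges over all degrees, but the
    interleaving has cubes in degrees 0 and 1 only, where \<open>model_mult\<close> is the
    identity.\<close>
  have "n \<le> 1" if "x \<in> Cubes (interleave S T) n" for n x
    using that by (auto simp: TS.Cubes_tens split: if_splits)
  then have "restricts_to_identity (model_mult S T) (hda.truncate (interleave S T))"
    using Cubes_tensor_model[of _ S T]
    by (auto simp: restricts_to_identity_def hda.defs HDA.Labels_tens TS.Labels_tens)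
  then show ?thesis
    using model_mult_iso[OF assms] by (simp add: is_structure_iso_def map_obj_model)
qed

lemma is_structure_iso_unique:
  assumes "is_lts S" "is_lts T" "is_structure_iso S T f"
  shows "f = model_mult S T"
proof (rule Hom_model_eqI[OF _ model_mult_Hom[OF assms(1,2)]])
  show "f \<in> Hom HDA_ext (tensor (model S) (model T)) (model (interleave S T))"
    using assms(3) by (auto simp: is_structure_iso_def is_iso_def map_obj_model Hom_def HDA_ext_def)
  have "restricts_to_identity f (hda.truncate (interleave S T))"
    using assms(3) by (simp add: is_structure_iso_def)
  note f = restricts_to_identity_low[OF this]
  show "on_cubes f n x = on_cubes (model_mult S T) n x"
    if "n \<le> 1" "x \<in> Cubes (tensor (model S) (model T)) n" for n x
    using f(1)[OF that] that by simp
  show "on_labels f a = on_labels (model_mult S T) a"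
    if "a \<in> Labels (tensor (model S) (model T))" for a
    using f(2)[OF that] that by simp
qed

theorem theorem5p10:
  "\<exists>\<phi> \<epsilon>.
     strong_monoidal_functor
       (TS_ltimes :: ('a el lts, ('a el lts, 'a el) mor) moncat_data)
       (HDA_ext :: ('a el hda, ('a el hda, 'a el) mor) moncat_data)
       HDA_model \<phi> \<epsilon> \<and>
     (\<forall>S \<in> Obj TS_ltimes. \<forall>T \<in> Obj TS_ltimes.
        is_structure_iso S T (\<phi> S T) \<and> (\<forall>f. is_structure_iso S T f \<longrightarrow> f = \<phi> S T))"
proof (intro exI conjI ballI allI impI)
  show "strong_monoidal_functor TS_ltimes HDA_ext HDA_model model_mult model_unit"
    by (rule strong_monoidal_functor_model)
  fix S T :: "'a el lts"
  assume "S \<in> Obj TS_ltimes" "T \<in> Obj TS_ltimes"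
  then have "is_lts S" "is_lts T"
    by (simp_all add: TS_simps)
  then show "is_structure_iso S T (model_mult S T)"
    "\<And>f. is_structure_iso S T f \<Longrightarrow> f = model_mult S T"
    by (rule is_structure_iso_model_mult is_structure_iso_unique)+
qed

end
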